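(* Let $Y\in\widehat{\mathcal{SN}}_{\mathrm{nd}}$ be a non-degenerate doubly-resonant saddle-node, with associated $\lambda\in\mathbb{C}^*$ (i.e. $Y$ is conjugate by an element of $\widehat{\mathrm{Diff}}_{\mathrm{fib}}$ to a prepared vector field with this $\lambda$). Then there exists a fibered formal diffeomorphism $\Phi\in\widehat{\mathrm{Diff}}_{\mathrm{fib}}$ such that $$\Phi_*(Y)=x^2\frac{\partial}{\partial x}+\big(-\lambda+a_1x+c_1(v)\big)y_1\frac{\partial}{\partial y_1}+\big(\lambda+a_2x+c_2(v)\big)y_2\frac{\partial}{\partial y_2},$$ where $v:=y_1y_2$, $c_1,c_2\in v\,\mathbb{C}[[v]]$ are formal power series with zero constant term, and $a_1,a_2\in\mathbb{C}$ satisfy $a_1+a_2=\mathrm{res}(Y)$.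
   Context: Coordinates on $\mathbb{C}^3$ are $(x,\mathbf{y})=(x,y_1,y_2)$. $\mathfrak{m}$ is the maximal ideal of $\mathbb{C}[[x,\mathbf y]]$. A singular formal vector field is $Y=b\,\partial_x+b_1\partial_{y_1}+b_2\partial_{y_2}$ with $b,b_1,b_2\in\mathfrak{m}$. $\widehat{\mathrm{Diff}}$ is the group of formal diffeomorphisms of $\mathbb{C}^3$ fixing the origin, acting by $\Phi_*(Y)=(\mathrm{D}\Phi\cdot Y)\circ\Phi^{-1}$. $\widehat{\mathrm{Diff}}_{\mathrm{fib}}$ is the subgroup of fibered diffeomorphisms, of the form $(x,\mathbf y)\mapsto(x,\phi(x,\mathbf y))$. Call a formal vector field prepared (with $\lambda\in\mathbb{C}^*$) if it has the form $x^2\partial_x+(-\lambda y_1+F_1(x,\mathbf y))\partial_{y_1}+(\lambda y_2+F_2(x,\mathbf y))\partial_{y_2}$ with $F_1,F_2\in\mathfrak{m}^2$. A doubly-resonant saddle-node is a singular formal vector field that is $\widehat{\mathrm{Diff}}_{\mathrm{fib}}$-conjugate to a prepared one; $\widehat{\mathcal{SN}}$ is the set of all of them. Residue: for a prepared vector field write the coefficients of $\partial_{y_1},\partial_{y_2}$ as the vector $\alpha(x)+\mathbf A(x)\mathbf y+\mathbf f(x,\mathbf y)$, where $\alpha$ has entries in $x^2\mathbb{C}[[x]]$, $\mathbf A(x)$ is a $2\times2$ matrix over $\mathbb{C}[[x]]$ with $\mathbf A(0)=\mathrm{Diag}(-\lambda,\lambda)$, and $\mathbf f$ has entries in the square of the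 ideal $\langle y_1,y_2\rangle$ of $\mathbb{C}[[x,\mathbf y]]$. Then $\mathrm{res}(Y):=\left(\frac{\mathrm{Tr}\,\mathbf A(x)}{x}\right)_{|x=0}$. This number is invariant under $\widehat{\mathrm{Diff}}_{\mathrm{fib}}$-conjugacy, so it is defined for every $Y\in\widehat{\mathcal{SN}}$ via any prepared conjugate. $Y$ is non-degenerate if $\mathrm{res}(Y)\in\mathbb{C}\setminus\mathbb{Q}_{\le0}$; $\widehat{\mathcal{SN}}_{\mathrm{nd}}\subset\widehat{\mathcal{SN}}$ is the set of non-degenerate elements. *)

theory Defs
  imports "HOL-Analysis.Analysis" "HOL-Computational_Algebra.Formal_Power_Series"
begin

section \<open>Formal power series in three variables\<close>

text \<open>
  The ring \<open>C[[x, y1, y2]]\<close> is represented as the iterated power series ring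
  \<open>((C[[x]])[[y1]])[[y2]]\<close>: the outermost series is in \<open>y2\<close>, the innermost one in \<open>x\<close>.
\<close>

type_synonym fps3 = "complex fps fps fps"

definition coef3 :: "fps3 \<Rightarrow> nat \<Rightarrow> nat \<Rightarrow> nat \<Rightarrow> complex" where
  "coef3 F i j k = fps_nth (fps_nth (fps_nth F k) j) i"

definition Abs_fps3 :: "(nat \<Rightarrow> nat \<Rightarrow> nat \<Rightarrow> complex) \<Rightarrow> fps3" where
  "Abs_fps3 a = Abs_fps (\<lambda>k. Abs_fps (\<lambda>j. Abs_fps (\<lambda>i. a i j k)))"

definition const3 :: "complex \<Rightarrow> fps3" where
  "const3 c = fps_const (fps_const (fps_const c))"

definition X :: fps3 where "X = fps_const (fps_const fps_X)"
definition Y1 :: fps3 where "Y1 = fps_const fps_X"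
definition Y2 :: fps3 where "Y2 = fps_X"

definition max_ideal :: "fps3 set" where
  "max_ideal = {F. coef3 F 0 0 0 = 0}"

definition max_ideal_sq :: "fps3 set" where
  "max_ideal_sq = {(\<Sum>n<N. f n * g n) | (N::nat) f g.
     \<forall>n<N. f n \<in> max_ideal \<and> g n \<in> max_ideal}"

lemma max_ideal_sqD: "F \<in> max_ideal_sq \<Longrightarrow> i+j+k<2 \<Longrightarrow> coef3 F i j k = 0"
  by (cases i; cases j; cases k) (auto simp: max_ideal_sq_def max_ideal_def coef3_def fps_sum_nth fps_mult_nth)
lemma max_ideal_sqI: assumes "\<And>i j k. i+j+k<2 \<Longrightarrow> coef3 F i j k = 0" shows "F \<in> max_ideal_sq"
proof -
  let ?G = "fps_nth F 0" let ?H = "fps_nth ?G 0"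
  have "F = fps_const ?G + Y2 * fps_shift 1 F"
    by (rule fps_ext) (auto simp: Y2_def)
  also have "?G = fps_const ?H + fps_X * fps_shift 1 ?G"
    by (rule fps_ext) auto
  also have "?H = fps_X * fps_shift 1 ?H"
    using assms[of 0 0 0] by (intro fps_ext) (auto simp: coef3_def)
  finally have e: "F = X * fps_const (fps_const (fps_shift 1 ?H)) + Y1 * fps_const (fps_shift 1 ?G) + Y2 * fps_shift 1 F"
    by (simp add: X_def Y1_def flip: fps_const_add fps_const_mult)
  let ?f = "\<lambda>n::nat. if n=0 then X else if n=1 then Y1 else Y2"
  let ?g = "\<lambda>n::nat. if n=0 then fps_const (fps_const (fps_shift 1 ?H)) else if n=1 then fps_const (fps_shift 1 ?G) else fps_shift 1 F"
  have "F = (\<Sum>n<3. ?f n * ?g n)" using e by (simp add: eval_nat_numeral)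
  moreover have "\<forall>n<3. ?f n \<in> max_ideal \<and> ?g n \<in> max_ideal"
    using assms[of 1 0 0] assms[of 0 1 0] assms[of 0 0 1]
    by (auto simp: max_ideal_def coef3_def X_def Y1_def Y2_def)
  ultimately show ?thesis unfolding max_ideal_sq_def
    by (intro CollectI exI[of _ 3] exI[of _ ?f] exI[of _ ?g] conjI)
qed

text \<open>The partial derivatives; indices \<open>1, 2, 3\<close> stand for \<open>x, y1, y2\<close>.\<close>

definition pderiv3 :: "3 \<Rightarrow> fps3 \<Rightarrow> fps3" where
  "pderiv3 m F =
    (if m = 1 then Abs_fps (\<lambda>k. Abs_fps (\<lambda>j. fps_deriv (fps_nth (fps_nth F k) j)))
     else if m = 2 then Abs_fps (\<lambda>k. fps_deriv (fps_nth F k))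
     else fps_deriv F)"

text \<open>
  Substitution \<open>F(G1, G2, G3) = \<Sum> F_pqr G1^p G2^q G3^r\<close>, meaningful for \<open>G1, G2, G3\<close>
  in the maximal ideal: then \<open>G1^p G2^q G3^r\<close> has order at least \<open>p + q + r\<close>, so the
  truncation below drops only terms that do not contribute to the coefficient.
\<close>

definition subst3 :: "fps3 \<Rightarrow> fps3 ^ 3 \<Rightarrow> fps3" where
  "subst3 F G = Abs_fps3 (\<lambda>i j k.
     \<Sum>p\<le>i+j+k. \<Sum>q\<le>i+j+k. \<Sum>r\<le>i+j+k.
       coef3 F p q r * coef3 ((G $ 1) ^ p * (G $ 2) ^ q * (G $ 3) ^ r) i j k)"

text \<open>
  \<open>c(v)\<close> with \<open>v = y1 y2\<close>, for a univariate series \<open>c\<close>: its coefficients are embedded as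
  constants and the library composition of series in the outermost variable is used
  (\<open>v\<close> has no constant term with respect to \<open>y2\<close>).
\<close>

definition eval_v :: "complex fps \<Rightarrow> fps3" where
  "eval_v c = Abs_fps (\<lambda>n. fps_const (fps_const (fps_nth c n))) oo (Y1 * Y2)"

lemma coef3_eval_v: "coef3 (eval_v c) i j k = (if i = 0 \<and> j = k then fps_nth c k else 0)"
proof -
  have p: "fps_nth ((Y1*Y2)^n) k = (if n = k then fps_X^n else 0)" for n
    by (simp add: Y1_def Y2_def power_mult_distrib fps_const_power fps_X_power_nth)
  show ?thesis
    by (simp add: coef3_def eval_v_def fps_compose_def p if_distrib[of "\<lambda>x. _ * x"] sum.delta cong: if_cong)
qed


section \<open>Formal vector fields and formal diffeomorphisms\<close>

text \<open>
  A vector \<open>(b, b1, b2)\<close> of type \<open>fps3 ^ 3\<close> stands for the vector field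
  \<open>b \<partial>/\<partial>x + b1 \<partial>/\<partial>y1 + b2 \<partial>/\<partial>y2\<close>, and also for the formal map with these components.
\<close>

definition singular_vf :: "fps3 ^ 3 \<Rightarrow> bool" where
  "singular_vf Y \<longleftrightarrow> (\<forall>m. Y $ m \<in> max_ideal)"

definition jacobian :: "fps3 ^ 3 \<Rightarrow> fps3 ^ 3 ^ 3" where
  "jacobian \<Phi> = (\<chi> l m. pderiv3 m (\<Phi> $ l))"

definition Diff :: "(fps3 ^ 3) set" where
  "Diff = {\<Phi>. (\<forall>m. \<Phi> $ m \<in> max_ideal) \<and>
               invertible (\<chi> l m. coef3 (jacobian \<Phi> $ l $ m) 0 0 0)}"

definition Diff_fib :: "(fps3 ^ 3) set" where
  "Diff_fib = {\<Phi> \<in> Diff. \<Phi> $ 1 = X}"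

definition id_map :: "fps3 ^ 3" where
  "id_map = vector [X, Y1, Y2]"

definition comp_map :: "fps3 ^ 3 \<Rightarrow> fps3 ^ 3 \<Rightarrow> fps3 ^ 3" where
  "comp_map F G = (\<chi> m. subst3 (F $ m) G)"

definition inv_map :: "fps3 ^ 3 \<Rightarrow> fps3 ^ 3" where
  "inv_map \<Phi> = (THE \<Psi>. \<Psi> \<in> Diff \<and> comp_map \<Phi> \<Psi> = id_map \<and> comp_map \<Psi> \<Phi> = id_map)"

definition push_forward :: "fps3 ^ 3 \<Rightarrow> fps3 ^ 3 \<Rightarrow> fps3 ^ 3" where
  "push_forward \<Phi> Y = comp_map (jacobian \<Phi> *v Y) (inv_map \<Phi>)"


section \<open>Doubly-resonant saddle-nodes\<close>

definition prepared :: "complex \<Rightarrow> fps3 ^ 3 \<Rightarrow> bool" where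
  "prepared l Y \<longleftrightarrow> l \<noteq> 0 \<and>
     (\<exists>F1\<in>max_ideal_sq. \<exists>F2\<in>max_ideal_sq.
        Y = vector [X ^ 2, - const3 l * Y1 + F1, const3 l * Y2 + F2])"

definition fib_conj_prepared :: "fps3 ^ 3 \<Rightarrow> complex \<Rightarrow> fps3 ^ 3 \<Rightarrow> bool" where
  "fib_conj_prepared Y l Z \<longleftrightarrow> prepared l Z \<and> (\<exists>\<Phi>\<in>Diff_fib. push_forward \<Phi> Y = Z)"

definition SN :: "(fps3 ^ 3) set" where
  "SN = {Y. singular_vf Y \<and> (\<exists>l Z. fib_conj_prepared Y l Z)}"

text \<open>
  The matrix \<open>A(x)\<close> in the expansion \<open>\<alpha>(x) + A(x) y + f(x,y)\<close>, \<open>f \<in> \<langle>y1, y2\<rangle>^2\<close>, of the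
  components along \<open>y1, y2\<close>: its columns are the coefficients, in \<open>C[[x]]\<close>, of the
  monomials \<open>y1\<close> and \<open>y2\<close>.
\<close>

definition lin_part :: "fps3 ^ 3 \<Rightarrow> complex fps ^ 2 ^ 2" where
  "lin_part Y =
     vector [vector [fps_nth (fps_nth (Y $ 2) 0) 1, fps_nth (fps_nth (Y $ 2) 1) 0],
             vector [fps_nth (fps_nth (Y $ 3) 0) 1, fps_nth (fps_nth (Y $ 3) 1) 0]]"

definition prepared_res :: "fps3 ^ 3 \<Rightarrow> complex" where
  "prepared_res Y = fps_nth (trace (lin_part Y) / fps_X) 0"

text \<open>
  The value does not depend on the prepared conjugate that is chosen, since
  \<open>prepared_res\<close> is invariant under fibered conjugacy.
\<close>

definition res :: "fps3 ^ 3 \<Rightarrow> complex" where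
  "res Y = prepared_res (SOME Z. \<exists>l. fib_conj_prepared Y l Z)"

definition SN_nd :: "(fps3 ^ 3) set" where
  "SN_nd = {Y \<in> SN. res Y \<notin> {of_rat q | q. q \<le> 0}}"

definition normal_form ::
  "complex \<Rightarrow> complex \<Rightarrow> complex \<Rightarrow> complex fps \<Rightarrow> complex fps \<Rightarrow> fps3 ^ 3" where
  "normal_form l a1 a2 c1 c2 =
     vector [X ^ 2,
             (- const3 l + const3 a1 * X + eval_v c1) * Y1,
             (const3 l + const3 a2 * X + eval_v c2) * Y2]"

end

theory Submission
  imports Defs
begin

text \<open>
  Conjugations are sought in the inverse direction, as solutions \<open>\<Psi>\<close> of \<open>D\<Psi> \<cdot> N = Z \<circ> \<Psi>\<close> in which
  the simpler vector field \<open>N\<close> is unknown as well. Such an equation is a fixed-point equation for an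
  operator that determines the terms of each degree from those of lower degree. A first conjugation
  (Poincare-Dulac) removes all terms but the resonant ones \<open>x^i v^k y1 \<partial>/\<partial>y1\<close> and
  \<open>x^i v^k y2 \<partial>/\<partial>y2\<close>. A second one, of the form \<open>(x, y1 E1, y2 E2)\<close> with \<open>E1, E2\<close> series in \<open>x\<close>
  and \<open>v\<close>, removes those with coefficient \<open>x^(i+1) v^k\<close>, \<open>(i, k) \<noteq> (0, 0)\<close>: the divisors that occur
  are \<open>i + k res(Y)\<close>, nonzero by non-degeneracy.

  Invariance of the residue under conjugacy is bypassed: the residue of \<open>Y\<close> is that of one
  particular prepared conjugate. Its \<open>\<lambda>\<close> agrees with the given one up to sign, as linear parts at the
  origin show, and exchanging \<open>y1\<close> and \<open>y2\<close> changes that sign.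
\<close>

subsection \<open>Coefficients and orders\<close>

lemma fps3_eqI: "(\<And>i j k. coef3 F i j k = coef3 G i j k) \<Longrightarrow> F = G"
  by (intro fps_ext) (simp add: coef3_def)

lemma coef3_Abs_fps3 [simp]: "coef3 (Abs_fps3 a) i j k = a i j k"
  by (simp add: coef3_def Abs_fps3_def)

lemma coef3_add [simp]: "coef3 (F + G) i j k = coef3 F i j k + coef3 G i j k"
  and coef3_diff [simp]: "coef3 (F - G) i j k = coef3 F i j k - coef3 G i j k"
  and coef3_uminus [simp]: "coef3 (- F) i j k = - coef3 F i j k"
  and coef3_zero [simp]: "coef3 0 i j k = 0"
  by (simp_all add: coef3_def)

lemma coef3_sum [simp]: "coef3 (sum f A) i j k = (\<Sum>a\<in>A. coef3 (f a) i j k)"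
  by (simp add: coef3_def fps_sum_nth)

lemma coef3_const3: "coef3 (const3 c) i j k = (if i = 0 \<and> j = 0 \<and> k = 0 then c else 0)"
  by (simp add: coef3_def const3_def)

lemma coef3_one: "coef3 1 i j k = (if i = 0 \<and> j = 0 \<and> k = 0 then 1 else 0)"
  by (simp add: coef3_def)

lemma const3_0 [simp]: "const3 0 = 0" and const3_1 [simp]: "const3 1 = 1"
  and const3_add: "const3 (a + b) = const3 a + const3 b"
  and const3_minus: "const3 (- a) = - const3 a"
  and const3_mult: "const3 (a * b) = const3 a * const3 b"
  by (simp_all add: const3_def flip: fps_const_add fps_const_mult fps_const_neg)

lemma const3_sum: "const3 (sum f A) = (\<Sum>a\<in>A. const3 (f a))"
  by (induction A rule: infinite_finite_induct) (simp_all add: const3_add)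

lemma coef3_const3_mult [simp]: "coef3 (const3 c * F) i j k = c * coef3 F i j k"
  by (simp add: coef3_def const3_def)

lemma coef3_X_mult: "coef3 (X * F) i j k = (if i = 0 then 0 else coef3 F (i - 1) j k)"
  and coef3_Y1_mult: "coef3 (Y1 * F) i j k = (if j = 0 then 0 else coef3 F i (j - 1) k)"
  and coef3_Y2_mult: "coef3 (Y2 * F) i j k = (if k = 0 then 0 else coef3 F i j (k - 1))"
  by (simp_all add: coef3_def X_def Y1_def Y2_def)

lemma coef3_X: "coef3 X i j k = (if i = 1 \<and> j = 0 \<and> k = 0 then 1 else 0)"
  and coef3_Y1: "coef3 Y1 i j k = (if i = 0 \<and> j = 1 \<and> k = 0 then 1 else 0)"
  and coef3_Y2: "coef3 Y2 i j k = (if i = 0 \<and> j = 0 \<and> k = 1 then 1 else 0)"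
  by (auto simp: coef3_def X_def Y1_def Y2_def)

lemma coef3_mult:
  "coef3 (F * G) i j k =
     (\<Sum>k'=0..k. \<Sum>j'=0..j. \<Sum>i'=0..i. coef3 F i' j' k' * coef3 G (i - i') (j - j') (k - k'))"
  by (simp add: coef3_def fps_mult_nth fps_sum_nth)

lemma coef3_mult_000 [simp]: "coef3 (F * G) 0 0 0 = coef3 F 0 0 0 * coef3 G 0 0 0"
  by (simp add: coef3_mult)

lemma coef3_pderiv3:
  "coef3 (pderiv3 1 F) i j k = of_nat (i + 1) * coef3 F (i + 1) j k"
  "coef3 (pderiv3 2 F) i j k = of_nat (j + 1) * coef3 F i (j + 1) k"
  "coef3 (pderiv3 3 F) i j k = of_nat (k + 1) * coef3 F i j (k + 1)"
proof -
  have *: "fps_nth (of_nat n * f) m = of_nat n * fps_nth f m"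
    for n m and f :: "'a :: comm_ring_1 fps"
    using fps_mult_left_const_nth[of "of_nat n" f m] by (simp add: fps_of_nat)
  show "coef3 (pderiv3 1 F) i j k = of_nat (i + 1) * coef3 F (i + 1) j k"
    "coef3 (pderiv3 2 F) i j k = of_nat (j + 1) * coef3 F i (j + 1) k"
    "coef3 (pderiv3 3 F) i j k = of_nat (k + 1) * coef3 F i j (k + 1)"
    by (simp_all add: coef3_def pderiv3_def * del: of_nat_Suc of_nat_add)
qed

section \<open>The filtration by powers of the maximal ideal\<close>

definition order_ge :: "nat \<Rightarrow> fps3 \<Rightarrow> bool" where
  "order_ge n F \<longleftrightarrow> (\<forall>i j k. i + j + k < n \<longrightarrow> coef3 F i j k = 0)"

lemma order_geD: "order_ge n F \<Longrightarrow> i + j + k < n \<Longrightarrow> coef3 F i j k = 0"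
  by (simp add: order_ge_def)

lemma order_ge_antimono: "order_ge n F \<Longrightarrow> m \<le> n \<Longrightarrow> order_ge m F"
  by (simp add: order_ge_def)

lemma order_ge_0 [simp]: "order_ge 0 F" and order_ge_zero [simp]: "order_ge n 0"
  by (simp_all add: order_ge_def)

lemma order_ge_add: "order_ge n F \<Longrightarrow> order_ge n G \<Longrightarrow> order_ge n (F + G)"
  and order_ge_diff: "order_ge n F \<Longrightarrow> order_ge n G \<Longrightarrow> order_ge n (F - G)"
  and order_ge_uminus: "order_ge n F \<Longrightarrow> order_ge n (- F)"
  by (simp_all add: order_ge_def)

lemma order_ge_sum: "(\<And>a. a \<in> A \<Longrightarrow> order_ge n (f a)) \<Longrightarrow> order_ge n (sum f A)"
  by (simp add: order_ge_def)

lemma order_ge_mult: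
  assumes "order_ge m F" "order_ge n G"
  shows "order_ge (m + n) (F * G)"
  unfolding order_ge_def
proof (intro allI impI)
  fix i j k assume d: "i + j + k < m + n"
  have "coef3 F i' j' k' * coef3 G (i - i') (j - j') (k - k') = 0"
    if "i' \<le> i" "j' \<le> j" "k' \<le> k" for i' j' k'
  proof (cases "i' + j' + k' < m")
    case False
    then have "(i - i') + (j - j') + (k - k') < n" using d that by linarith
    then show ?thesis using assms(2) by (simp add: order_ge_def)
  qed (use assms(1) in \<open>simp add: order_ge_def\<close>)
  then show "coef3 (F * G) i j k = 0"
    by (auto simp: coef3_mult intro!: sum.neutral)
qed

lemma order_ge_mult': "order_ge m F \<Longrightarrow> order_ge n G \<Longrightarrow> l \<le> m + n \<Longrightarrow> order_ge l (F * G)"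
  using order_ge_mult order_ge_antimono by blast

lemma order_ge_multL: "order_ge n F \<Longrightarrow> order_ge n (F * G)"
  and order_ge_multR: "order_ge n G \<Longrightarrow> order_ge n (F * G)"
  by (rule order_ge_mult'[where m = n and n = 0]; simp)
     (rule order_ge_mult'[where m = 0 and n = n]; simp)

text \<open>Splitting the difference as \<open>(F - F') * G + F' * (G - G')\<close> lets each term
  gain degree from its other factor. This is how the operators below are shown to raise the order of
  differences.\<close>

lemma order_ge_mult_diff:
  assumes "order_ge a (F - F')" "order_ge b G" "order_ge c F'" "order_ge d (G - G')"
    "n \<le> a + b" "n \<le> c + d"
  shows "order_ge n (F * G - F' * G')"
proof -
  have "F * G - F' * G' = (F - F') * G + F' * (G - G')" by (simp add: algebra_simps)
  then show ?thesis using assms by (auto intro!: order_ge_add order_ge_mult')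
qed

lemma order_ge_power: "order_ge 1 F \<Longrightarrow> order_ge n (F ^ n)"
proof (induction n)
  case (Suc n)
  then show ?case using order_ge_mult[of 1 F n "F ^ n"] by simp
qed simp

lemma order_ge_X [simp]: "order_ge (Suc 0) X" and order_ge_Y1 [simp]: "order_ge (Suc 0) Y1"
  and order_ge_Y2 [simp]: "order_ge (Suc 0) Y2"
  by (simp_all add: order_ge_def coef3_X coef3_Y1 coef3_Y2)

lemma order_ge_pderiv3: "order_ge (Suc n) F \<Longrightarrow> order_ge n (pderiv3 m F)"
  using exhaust_3[of m] by (auto simp: order_ge_def coef3_pderiv3)

lemma max_ideal_iff: "F \<in> max_ideal \<longleftrightarrow> order_ge 1 F"
  by (simp add: max_ideal_def order_ge_def)

lemma max_ideal_sq_iff: "F \<in> max_ideal_sq \<longleftrightarrow> order_ge 2 F"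
  by (auto simp: order_ge_def intro!: max_ideal_sqI dest: max_ideal_sqD)

lemma order_ge_all_imp_zero: "(\<And>n. order_ge n F) \<Longrightarrow> F = 0"
proof (rule fps3_eqI)
  fix i j k assume "\<And>n. order_ge n F"
  from order_geD[OF this[of "Suc (i+j+k)"], of i j k] show "coef3 F i j k = coef3 0 i j k" by simp
qed

text \<open>The filtration is separated: the difference of two series with common approximations to
  every order lies in all powers of the maximal ideal, hence is zero.\<close>

lemma order_ge_limit_eq:
  assumes "\<And>n. \<exists>H. order_ge n (F - H) \<and> order_ge n (G - H)"
  shows "F = G"
proof -
  have "order_ge n (F - G)" for n
  proof -
    obtain H where "order_ge n (F - H)" "order_ge n (G - H)" using assms by blast
    from order_ge_diff[OF this] show ?thesis by simp
  qed
  from order_ge_all_imp_zero[OF this] show ?thesis by simp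
qed

section \<open>Polynomial approximation as an induction principle\<close>

lemma fps3_decomp:
  obtains A B C where "F = const3 (coef3 F 0 0 0) + X * A + Y1 * B + Y2 * C"
proof -
  \<comment> \<open>Monomials divisible by y2 go to \<open>?C\<close>, the remaining ones divisible
    by y1 to \<open>?B\<close>, and the positive powers of x to \<open>?A\<close>.\<close>
  let ?A = "Abs_fps3 (\<lambda>i j k. if j = 0 \<and> k = 0 then coef3 F (Suc i) 0 0 else 0)"
  let ?B = "Abs_fps3 (\<lambda>i j k. if k = 0 then coef3 F i (Suc j) 0 else 0)"
  let ?C = "Abs_fps3 (\<lambda>i j k. coef3 F i j (Suc k))"
  have "F = const3 (coef3 F 0 0 0) + X * ?A + Y1 * ?B + Y2 * ?C"
    by (rule fps3_eqI) (auto simp: coef3_const3 coef3_X_mult coef3_Y1_mult coef3_Y2_mult gr0_conv_Suc)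
  then show ?thesis by (rule that)
qed

text \<open>Polynomials are dense and arise from constants by sums and multiplication by variables;
  \<open>limit\<close> passes to the closure. The Leibniz rule, the chain rule and multiplicativity
  of substitution thus reduce to multiplication by one variable.\<close>

lemma fps3_induct [case_names const add X Y1 Y2 limit]:
  assumes "\<And>c. P (const3 c)"
    and "\<And>F G. P F \<Longrightarrow> P G \<Longrightarrow> P (F + G)"
    and "\<And>F. P F \<Longrightarrow> P (X * F)" "\<And>F. P F \<Longrightarrow> P (Y1 * F)" "\<And>F. P F \<Longrightarrow> P (Y2 * F)"
    and "\<And>F. (\<And>n. \<exists>G. P G \<and> order_ge n (F - G)) \<Longrightarrow> P F"
  shows "P F"
proof -
  have "\<exists>G. P G \<and> order_ge n (F - G)" for n
  proof (induction n arbitrary: F)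
    case 0
    show ?case using assms(1) by auto
  next
    case (Suc n)
    obtain A B C where F: "F = const3 (coef3 F 0 0 0) + X * A + Y1 * B + Y2 * C"
      by (rule fps3_decomp)
    obtain A' B' C' where *: "P A'" "order_ge n (A - A')" "P B'" "order_ge n (B - B')"
      "P C'" "order_ge n (C - C')"
      using Suc.IH by metis
    let ?G = "const3 (coef3 F 0 0 0) + X * A' + Y1 * B' + Y2 * C'"
    have "P ?G" using * by (auto intro!: assms(1-5))
    moreover have "F - ?G = X * (A - A') + Y1 * (B - B') + Y2 * (C - C')"
      by (subst F) (simp add: algebra_simps)
    then have "order_ge (Suc n) (F - ?G)"
      using * by (auto intro!: order_ge_add order_ge_mult'[of 1 _ n])
    ultimately show ?case by blast
  qed
  then show ?thesis by (rule assms(6))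
qed

subsection \<open>Partial derivatives\<close>

lemma pderiv3_add: "pderiv3 m (F + G) = pderiv3 m F + pderiv3 m G"
  and pderiv3_diff: "pderiv3 m (F - G) = pderiv3 m F - pderiv3 m G"
  and pderiv3_uminus: "pderiv3 m (- F) = - pderiv3 m F"
  and pderiv3_const3_mult: "pderiv3 m (const3 c * F) = const3 c * pderiv3 m F"
  and pderiv3_const3 [simp]: "pderiv3 m (const3 c) = 0"
  using exhaust_3[of m]
  by (auto intro!: fps3_eqI simp: coef3_pderiv3 distrib_left right_diff_distrib coef3_const3)

lemma pderiv3_sum: "pderiv3 m (sum f A) = (\<Sum>a\<in>A. pderiv3 m (f a))"
  using exhaust_3[of m]
  by (auto intro!: fps3_eqI simp: coef3_pderiv3 sum_distrib_left)

lemma pderiv3_X: "pderiv3 m X = (if m = 1 then 1 else 0)"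
  and pderiv3_Y1: "pderiv3 m Y1 = (if m = 2 then 1 else 0)"
  and pderiv3_Y2: "pderiv3 m Y2 = (if m = 3 then 1 else 0)"
  using exhaust_3[of m]
  by (auto intro!: fps3_eqI simp: coef3_pderiv3 coef3_X coef3_Y1 coef3_Y2 coef3_one)

lemma pderiv3_var_mult:
  "pderiv3 m (X * F) = X * pderiv3 m F + pderiv3 m X * F"
  "pderiv3 m (Y1 * F) = Y1 * pderiv3 m F + pderiv3 m Y1 * F"
  "pderiv3 m (Y2 * F) = Y2 * pderiv3 m F + pderiv3 m Y2 * F"
  using exhaust_3[of m]
  by (auto intro!: fps3_eqI
      simp: coef3_pderiv3 coef3_X_mult coef3_Y1_mult coef3_Y2_mult pderiv3_X pderiv3_Y1 pderiv3_Y2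
        algebra_simps of_nat_diff gr0_conv_Suc)

lemma pderiv3_mult: "pderiv3 m (F * G) = F * pderiv3 m G + pderiv3 m F * G"
proof (induction F rule: fps3_induct)
  case (limit F)
  show ?case
  proof (rule order_ge_limit_eq)
    fix n
    \<comment> \<open>Differentiation costs one degree, so the approximation is taken one order
      better.\<close>
    obtain H where H: "pderiv3 m (H * G) = H * pderiv3 m G + pderiv3 m H * G" "order_ge (Suc n) (F - H)"
      using limit by blast
    have "pderiv3 m (F * G) - pderiv3 m (H * G) = pderiv3 m ((F - H) * G)"
      by (simp add: left_diff_distrib flip: pderiv3_diff)
    then have "order_ge n (pderiv3 m (F * G) - pderiv3 m (H * G))"
      using H(2) by (simp add: order_ge_pderiv3 order_ge_multL)
    moreover have "F * pderiv3 m G + pderiv3 m F * G - pderiv3 m (H * G)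
        = (F - H) * pderiv3 m G + pderiv3 m (F - H) * G"
      unfolding H(1) by (simp add: pderiv3_diff algebra_simps)
    then have "order_ge n (F * pderiv3 m G + pderiv3 m F * G - pderiv3 m (H * G))"
      using H(2) by (auto intro!: order_ge_add order_ge_multL order_ge_pderiv3 intro: order_ge_antimono)
    ultimately show "\<exists>H. order_ge n (pderiv3 m (F * G) - H) \<and>
      order_ge n (F * pderiv3 m G + pderiv3 m F * G - H)" by blast
  qed
qed (simp_all add: pderiv3_const3_mult pderiv3_add pderiv3_var_mult mult.assoc distrib_left distrib_right)

subsection \<open>Substitution\<close>

definition vanishing :: "fps3 ^ 'n \<Rightarrow> bool" where
  "vanishing G \<longleftrightarrow> (\<forall>m. order_ge 1 (G $ m))"

lemma vanishingD [simp]: "vanishing G \<Longrightarrow> order_ge (Suc 0) (G $ m)"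
  by (simp add: vanishing_def)

text \<open>Products of more than i + j + k components of \<open>G\<close> do not reach this
  coefficient, so the three summation bounds can be enlarged independently. Shifting a single index
  in \<open>subst3_var_mult\<close> relies on this.\<close>

lemma coef3_subst3:
  assumes "vanishing G" "i + j + k < a" "i + j + k < b" "i + j + k < c"
  shows "coef3 (subst3 F G) i j k = (\<Sum>p<a. \<Sum>q<b. \<Sum>r<c.
           coef3 F p q r * coef3 ((G $ 1) ^ p * (G $ 2) ^ q * (G $ 3) ^ r) i j k)"
proof -
  let ?n = "i + j + k"
  let ?t = "\<lambda>p q r. coef3 F p q r * coef3 ((G $ 1) ^ p * (G $ 2) ^ q * (G $ 3) ^ r) i j k"
  have "order_ge (p + q + r) ((G $ 1) ^ p * (G $ 2) ^ q * (G $ 3) ^ r)" for p q r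
    using assms(1) by (intro order_ge_mult order_ge_power) (auto simp: vanishing_def)
  then have 0: "coef3 ((G $ 1) ^ p * (G $ 2) ^ q * (G $ 3) ^ r) i j k = 0" if "?n < p + q + r" for p q r
    using that by (auto dest: order_geD)
  have "(\<Sum>p<a. \<Sum>q<b. \<Sum>r<c. ?t p q r) = (\<Sum>p\<le>?n. \<Sum>q<b. \<Sum>r<c. ?t p q r)"
    using assms by (intro sum.mono_neutral_right) (auto intro!: sum.neutral simp: 0)
  also have "\<dots> = (\<Sum>p\<le>?n. \<Sum>q\<le>?n. \<Sum>r<c. ?t p q r)"
    using assms by (rule_tac sum.cong[OF refl], intro sum.mono_neutral_right) (auto intro!: sum.neutral simp: 0)
  also have "\<dots> = (\<Sum>p\<le>?n. \<Sum>q\<le>?n. \<Sum>r\<le>?n. ?t p q r)"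
    using assms by (rule_tac sum.cong[OF refl], rule_tac sum.cong[OF refl], intro sum.mono_neutral_right) (auto simp: 0)
  finally show ?thesis by (simp add: subst3_def)
qed

lemma subst3_add: "subst3 (F + F') G = subst3 F G + subst3 F' G"
  and subst3_diff: "subst3 (F - F') G = subst3 F G - subst3 F' G"
  and subst3_uminus: "subst3 (- F) G = - subst3 F G"
  and subst3_const3_mult: "subst3 (const3 c * F) G = const3 c * subst3 F G"
  by (rule fps3_eqI;
      simp add: subst3_def distrib_right left_diff_distrib mult.assoc sum.distrib sum_subtractf
        sum_negf sum_distrib_left)+

lemma subst3_zero [simp]: "subst3 0 G = 0"
  by (rule fps3_eqI) (simp add: subst3_def)

lemma subst3_sum: "subst3 (sum f A) G = (\<Sum>a\<in>A. subst3 (f a) G)"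
  by (induction A rule: infinite_finite_induct) (simp_all add: subst3_add)

lemma coef3_subst3_000 [simp]: "coef3 (subst3 F G) 0 0 0 = coef3 F 0 0 0"
  by (simp add: subst3_def coef3_one)

lemma subst3_one [simp]: "subst3 1 G = 1"
proof (rule fps3_eqI)
  fix i j k
  have "coef3 (subst3 1 G) i j k = (\<Sum>p\<le>i+j+k. \<Sum>q\<le>i+j+k. \<Sum>r\<le>i+j+k.
     if r = 0 then if q = 0 then if p = 0 then coef3 1 i j k else 0 else 0 else 0)"
    unfolding subst3_def coef3_Abs_fps3
    by (intro sum.cong refl) (simp add: coef3_one[of 0] coef3_one)
  then show "coef3 (subst3 1 G) i j k = coef3 1 i j k" by simp
qed

lemma subst3_const3 [simp]: "subst3 (const3 c) G = const3 c"
  using subst3_const3_mult[of c 1 G] by simp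

lemma order_ge_subst3:
  assumes "order_ge n F" "vanishing G"
  shows "order_ge n (subst3 F G)"
  unfolding order_ge_def
proof (intro allI impI)
  fix i j k assume n: "i + j + k < n"
  have "coef3 F p q r * coef3 ((G $ 1) ^ p * (G $ 2) ^ q * (G $ 3) ^ r) i j k = 0" for p q r
  proof (cases "p + q + r < n")
    case False
    have "order_ge (p + q + r) ((G $ 1) ^ p * (G $ 2) ^ q * (G $ 3) ^ r)"
      using assms(2) by (intro order_ge_mult order_ge_power) (auto simp: vanishing_def)
    from order_geD[OF this, of i j k] show ?thesis using False n by simp
  qed (use assms(1) in \<open>simp add: order_ge_def\<close>)
  then show "coef3 (subst3 F G) i j k = 0"
    by (auto simp: subst3_def intro!: sum.neutral)
qed

text \<open>Allows a substitution inside a product to be replaced by a finite sum with the same low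
  coefficients.\<close>

lemma coef3_mult_cong:
  assumes "\<And>i' j' k'. i' \<le> i \<Longrightarrow> j' \<le> j \<Longrightarrow> k' \<le> k \<Longrightarrow> coef3 F i' j' k' = coef3 G i' j' k'"
  shows "coef3 (H * F) i j k = coef3 (H * G) i j k"
  unfolding coef3_mult by (intro sum.cong refl) (simp add: assms)

text \<open>Multiplying \<open>F\<close> by a variable shifts one index of summation, so the sum
  over that index runs one step further than the other two. By \<open>fps3_induct\<close>, these
  rules make substitution a ring homomorphism.\<close>

lemma subst3_var_mult:
  assumes "vanishing G"
  shows "subst3 (X * F) G = G $ 1 * subst3 F G"
    and "subst3 (Y1 * F) G = G $ 2 * subst3 F G"
    and "subst3 (Y2 * F) G = G $ 3 * subst3 F G"
proof -
  let ?M = "\<lambda>p q r. (G $ 1) ^ p * (G $ 2) ^ q * (G $ 3) ^ r"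
  have *: "coef3 (H * subst3 F G) i j k =
      (\<Sum>p<n. \<Sum>q<n. \<Sum>r<n. coef3 F p q r * coef3 (H * ?M p q r) i j k)"
    if n: "n = Suc (i + j + k)" for H i j k n
  proof -
    let ?S = "\<Sum>p<n. \<Sum>q<n. \<Sum>r<n. const3 (coef3 F p q r) * ?M p q r"
    have "coef3 (H * subst3 F G) i j k = coef3 (H * ?S) i j k"
      using n by (intro coef3_mult_cong) (simp add: coef3_subst3[OF assms, of _ _ _ n n n])
    also have "H * ?S = (\<Sum>p<n. \<Sum>q<n. \<Sum>r<n. const3 (coef3 F p q r) * (H * ?M p q r))"
      by (simp add: sum_distrib_left mult_ac)
    finally show ?thesis by simp
  qed
  show "subst3 (X * F) G = G $ 1 * subst3 F G"
  proof (rule fps3_eqI)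
    fix i j k :: nat
    obtain n where n: "n = Suc (i + j + k)" by simp
    then have m: "i + j + k < n" "i + j + k < Suc n" by simp_all
    show "coef3 (subst3 (X * F) G) i j k = coef3 (G $ 1 * subst3 F G) i j k"
      unfolding *[OF n] coef3_subst3[OF assms m(2) m(1) m(1)]
      by (simp add: sum.lessThan_Suc_shift[of _ n] coef3_X_mult mult_ac del: sum.lessThan_Suc)
  qed
  show "subst3 (Y1 * F) G = G $ 2 * subst3 F G"
  proof (rule fps3_eqI)
    fix i j k :: nat
    obtain n where n: "n = Suc (i + j + k)" by simp
    then have m: "i + j + k < n" "i + j + k < Suc n" by simp_all
    show "coef3 (subst3 (Y1 * F) G) i j k = coef3 (G $ 2 * subst3 F G) i j k"
      unfolding *[OF n] coef3_subst3[OF assms m(1) m(2) m(1)]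
      by (simp add: sum.lessThan_Suc_shift[of _ n] coef3_Y1_mult mult_ac del: sum.lessThan_Suc)
  qed
  show "subst3 (Y2 * F) G = G $ 3 * subst3 F G"
  proof (rule fps3_eqI)
    fix i j k :: nat
    obtain n where n: "n = Suc (i + j + k)" by simp
    then have m: "i + j + k < n" "i + j + k < Suc n" by simp_all
    show "coef3 (subst3 (Y2 * F) G) i j k = coef3 (G $ 3 * subst3 F G) i j k"
      unfolding *[OF n] coef3_subst3[OF assms m(1) m(1) m(2)]
      by (simp add: sum.lessThan_Suc_shift[of _ n] coef3_Y2_mult mult_ac del: sum.lessThan_Suc)
  qed
qed

lemma subst3_X: "vanishing G \<Longrightarrow> subst3 X G = G $ 1"
  and subst3_Y1: "vanishing G \<Longrightarrow> subst3 Y1 G = G $ 2"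
  and subst3_Y2: "vanishing G \<Longrightarrow> subst3 Y2 G = G $ 3"
  using subst3_var_mult[of G 1] by simp_all

lemma subst3_mult:
  assumes "vanishing G"
  shows "subst3 (F * F') G = subst3 F G * subst3 F' G"
proof (induction F rule: fps3_induct)
  case (limit F)
  show ?case
  proof (rule order_ge_limit_eq)
    fix n
    obtain H where H: "subst3 (H * F') G = subst3 H G * subst3 F' G" "order_ge n (F - H)"
      using limit by blast
    have "order_ge n (subst3 ((F - H) * F') G)"
      using H assms by (intro order_ge_subst3 order_ge_multL)
    moreover have "order_ge n (subst3 (F - H) G * subst3 F' G)"
      using H assms by (intro order_ge_subst3 order_ge_multL)
    ultimately show "\<exists>H. order_ge n (subst3 (F * F') G - H) \<and> order_ge n (subst3 F G * subst3 F' G - H)"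
      by (intro exI[of _ "subst3 (H * F') G"])
         (auto simp: H(1) subst3_diff subst3_add left_diff_distrib)
  qed
qed (simp_all add: subst3_add subst3_const3_mult subst3_var_mult assms mult.assoc distrib_right)

lemma subst3_power: "vanishing G \<Longrightarrow> subst3 (F ^ n) G = subst3 F G ^ n"
  by (induction n) (simp_all add: subst3_mult)

lemma comp_map_nth [simp]: "comp_map F G $ m = subst3 (F $ m) G"
  by (simp add: comp_map_def)

lemma vanishing_comp_map [simp]: "vanishing F \<Longrightarrow> vanishing G \<Longrightarrow> vanishing (comp_map F G)"
  by (auto simp: vanishing_def intro!: order_ge_subst3)

lemma subst3_subst3:
  assumes "vanishing G" "vanishing H"
  shows "subst3 (subst3 F G) H = subst3 F (comp_map G H)"
proof (induction F rule: fps3_induct)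
  case (limit F)
  show ?case
  proof (rule order_ge_limit_eq)
    fix n
    obtain F' where F': "subst3 (subst3 F' G) H = subst3 F' (comp_map G H)" "order_ge n (F - F')"
      using limit by blast
    have "order_ge n (subst3 (subst3 (F - F') G) H)"
      using F' assms by (intro order_ge_subst3)
    moreover have "order_ge n (subst3 (F - F') (comp_map G H))"
      using F' assms by (intro order_ge_subst3) auto
    ultimately show "\<exists>K. order_ge n (subst3 (subst3 F G) H - K) \<and>
        order_ge n (subst3 F (comp_map G H) - K)"
      by (intro exI[of _ "subst3 (subst3 F' G) H"]) (auto simp: F'(1) subst3_diff)
  qed
qed (simp_all add: subst3_add subst3_var_mult assms subst3_mult subst3_X subst3_Y1 subst3_Y2)

lemma comp_map_assoc:
  "vanishing G \<Longrightarrow> vanishing H \<Longrightarrow> comp_map (comp_map F G) H = comp_map F (comp_map G H)"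
  by (simp add: vec_eq_iff subst3_subst3)

lemma id_map_nth [simp]: "id_map $ 1 = X" "id_map $ 2 = Y1" "id_map $ 3 = Y2"
  by (simp_all add: id_map_def vector_3)

lemma vanishing_id_map [simp]: "vanishing id_map"
  by (simp add: vanishing_def forall_3)

lemma subst3_id_map [simp]: "subst3 F id_map = F"
proof (induction F rule: fps3_induct)
  case (limit F)
  show ?case
  proof (rule order_ge_limit_eq)
    fix n
    obtain F' where F': "subst3 F' id_map = F'" "order_ge n (F - F')"
      using limit by blast
    have "order_ge n (subst3 (F - F') id_map)"
      using F' by (intro order_ge_subst3) auto
    then show "\<exists>K. order_ge n (subst3 F id_map - K) \<and> order_ge n (F - K)"
      using F' by (intro exI[of _ F']) (auto simp: subst3_diff)
  qed
qed (simp_all add: subst3_add subst3_var_mult)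

lemma comp_map_id_right [simp]: "comp_map F id_map = F"
  and comp_map_id_left [simp]: "vanishing G \<Longrightarrow> comp_map id_map G = G"
  by (simp_all add: vec_eq_iff forall_3 subst3_X subst3_Y1 subst3_Y2)

text \<open>The chain rule. Besides additivity and continuity, \<open>fps3_induct\<close> asks only
  for the case of a variable times \<open>F\<close>, where the Leibniz rule applies to both
  sides.\<close>

lemma pderiv3_subst3:
  assumes "vanishing G"
  shows "pderiv3 m (subst3 F G) = (\<Sum>l\<in>UNIV. subst3 (pderiv3 l F) G * pderiv3 m (G $ l))"
proof (induction F rule: fps3_induct)
  case (limit F)
  let ?R = "\<lambda>F. \<Sum>l\<in>UNIV. subst3 (pderiv3 l F) G * pderiv3 m (G $ l)"
  show ?case
  proof (rule order_ge_limit_eq)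
    fix n
    obtain F' where F': "pderiv3 m (subst3 F' G) = ?R F'" "order_ge (Suc n) (F - F')"
      using limit by blast
    have "order_ge n (pderiv3 m (subst3 (F - F') G))"
      using F' assms by (intro order_ge_pderiv3 order_ge_subst3)
    moreover have "order_ge n (?R (F - F'))"
      using F' assms by (intro order_ge_sum order_ge_multL order_ge_subst3 order_ge_pderiv3)
    then have "order_ge n (?R F - ?R F')"
      by (simp add: pderiv3_diff subst3_diff left_diff_distrib sum_subtractf)
    ultimately show "\<exists>K. order_ge n (pderiv3 m (subst3 F G) - K) \<and> order_ge n (?R F - K)"
      by (intro exI[of _ "?R F'"]) (auto simp flip: F'(1) simp: subst3_diff pderiv3_diff)
  qed
qed (simp_all add: subst3_add subst3_var_mult pderiv3_add distrib_right sum.distrib sum_3 pderiv3_mult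
     pderiv3_var_mult pderiv3_X pderiv3_Y1 pderiv3_Y2 assms, simp_all add: algebra_simps)

lemma order_ge_subst3_diff:
  assumes "vanishing G" "vanishing G'" "\<And>m. order_ge n (G $ m - G' $ m)"
  shows "order_ge n (subst3 F G - subst3 F G')"
proof (induction F rule: fps3_induct)
  case (limit F)
  obtain F' where F': "order_ge n (subst3 F' G - subst3 F' G')" "order_ge n (F - F')"
    using limit by blast
  have "order_ge n (subst3 (F - F') G - subst3 (F - F') G')"
    by (intro order_ge_diff order_ge_subst3[OF F'(2)] assms)
  from order_ge_add[OF this F'(1)] show ?case by (simp add: subst3_diff)
next
  case (add F F')
  from order_ge_add[OF this] show ?case by (simp add: subst3_add algebra_simps)
qed (simp_all add: subst3_var_mult assms order_ge_mult_diff[where a = n and b = 0 and c = 0 and d = n])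

text \<open>A degree is gained because \<open>F\<close> has no constant or linear terms: after one
  variable is split off, the cofactors still vanish at the origin. Every fixed-point operator below
  composes such a series with the unknown map.\<close>

lemma order_ge_subst3_diff':
  assumes "vanishing G" "vanishing G'" "\<And>m. order_ge n (G $ m - G' $ m)" "order_ge 2 F"
  shows "order_ge (Suc n) (subst3 F G - subst3 F G')"
proof -
  obtain c A B C where F: "F = const3 c + X * A + Y1 * B + Y2 * C"
    by (rule fps3_decomp)
  have "coef3 A 0 0 0 = coef3 F 1 0 0" "coef3 B 0 0 0 = coef3 F 0 1 0" "coef3 C 0 0 0 = coef3 F 0 0 1"
    by (simp_all add: F coef3_const3 coef3_X_mult coef3_Y1_mult coef3_Y2_mult)
  then have ABC: "order_ge 1 A" "order_ge 1 B" "order_ge 1 C"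
    using assms(4) by (simp_all add: order_ge_def)
  have *: "order_ge (Suc n) (G $ m * subst3 H G - G' $ m * subst3 H G')" if "order_ge 1 H" for m H
    using assms that
    by (intro order_ge_mult_diff[where a = n and b = 1 and c = 1 and d = n] order_ge_subst3 order_ge_subst3_diff) auto
  have "subst3 F G - subst3 F G' =
     (G $ 1 * subst3 A G - G' $ 1 * subst3 A G') + (G $ 2 * subst3 B G - G' $ 2 * subst3 B G')
     + (G $ 3 * subst3 C G - G' $ 3 * subst3 C G')"
    unfolding F by (simp add: subst3_add subst3_var_mult assms)
  then show ?thesis by (simp only:) (intro order_ge_add * ABC)
qed

subsection \<open>Fixed points of degree-raising operators\<close>

text \<open>The contraction principle for the order filtration, by iteration from 0. The bound
  \<open>b\<close> restricts the estimates to unknowns that start in high enough degree, and the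
  operator preserves it.\<close>

lemma causal_fixpoint:
  fixes T :: "fps3 ^ 'n \<Rightarrow> fps3 ^ 'n"
  assumes closed: "\<And>F. (\<And>m. order_ge b (F $ m)) \<Longrightarrow> (\<And>m. order_ge b (T F $ m))"
    and causal: "\<And>n F G. (\<And>m. order_ge b (F $ m)) \<Longrightarrow> (\<And>m. order_ge b (G $ m)) \<Longrightarrow>
      (\<And>m. order_ge n (F $ m - G $ m)) \<Longrightarrow> (\<And>m. order_ge (Suc n) (T F $ m - T G $ m))"
  obtains F where "\<And>m. order_ge b (F $ m)" "T F = F"
proof -
  define it where "it n = (T ^^ n) 0" for n
  have b: "order_ge b (it n $ m)" for n m
    by (induction n arbitrary: m) (simp_all add: it_def closed)
  have step: "order_ge n (it (Suc n) $ m - it n $ m)" for n m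
  proof (induction n arbitrary: m)
    case (Suc n)
    show ?case using causal[OF b b Suc.IH] by (simp add: it_def)
  qed simp
  have mono: "order_ge n (it (n + d) $ m - it n $ m)" for n d m
  proof (induction d)
    case (Suc d)
    show ?case
      using order_ge_add[OF order_ge_antimono[OF step[of "n + d" m], of n] Suc.IH] by simp
  qed simp
  \<comment> \<open>Coefficients of total degree d no longer change from iterate d + 1 on, so the
    limit reads them off there.\<close>
  define L where "L = (\<chi> m. Abs_fps3 (\<lambda>i j k. coef3 (it (Suc (i + j + k)) $ m) i j k))"
  have L: "order_ge n (L $ m - it n $ m)" for n m
    unfolding order_ge_def
  proof (intro allI impI)
    fix i j k assume "i + j + k < n"
    then obtain d where "n = Suc (i + j + k) + d" using less_eqE[of "Suc (i + j + k)" n] by auto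
    then show "coef3 (L $ m - it n $ m) i j k = 0"
      using order_geD[OF mono[of "Suc (i + j + k)" d m], of i j k] by (simp add: L_def)
  qed
  have bL: "order_ge b (L $ m)" for m
    using b[of _ m] by (simp add: L_def order_ge_def)
  have "T L $ m = L $ m" for m
  proof (rule order_ge_limit_eq)
    fix n
    have "order_ge (Suc n) (T L $ m - it (Suc n) $ m)"
      using causal[OF bL b L[of n]] by (simp add: it_def)
    with L[of "Suc n" m] show "\<exists>H. order_ge n (T L $ m - H) \<and> order_ge n (L $ m - H)"
      by (intro exI[of _ "it (Suc n) $ m"]) (auto intro: order_ge_antimono)
  qed
  then show ?thesis using bL by (intro that[of L]) (simp_all add: vec_eq_iff)
qed

subsection \<open>Formal diffeomorphisms\<close>

text \<open>The linear part at the origin. It is applied to vector fields as well; for a prepared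
  one its eigenvalues are 0, -l and l.\<close>

definition lin0 :: "fps3 ^ 3 \<Rightarrow> complex ^ 3 ^ 3" where
  "lin0 \<Phi> = (\<chi> l m. coef3 (pderiv3 m (\<Phi> $ l)) 0 0 0)"

lemma Diff_iff: "\<Phi> \<in> Diff \<longleftrightarrow> vanishing \<Phi> \<and> invertible (lin0 \<Phi>)"
  by (simp add: Diff_def vanishing_def max_ideal_iff lin0_def jacobian_def)

lemma Diff_fib_iff: "\<Phi> \<in> Diff_fib \<longleftrightarrow> vanishing \<Phi> \<and> invertible (lin0 \<Phi>) \<and> \<Phi> $ 1 = X"
  by (auto simp: Diff_fib_def Diff_iff)

lemma jacobian_nth: "jacobian \<Phi> $ l $ m = pderiv3 m (\<Phi> $ l)"
  by (simp add: jacobian_def)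

lemma lin0_comp_map: "vanishing G \<Longrightarrow> lin0 (comp_map F G) = lin0 F ** lin0 G"
  by (simp add: lin0_def matrix_matrix_mult_def vec_eq_iff pderiv3_subst3)

lemma lin0_id_map [simp]: "lin0 id_map = mat 1"
  by (simp add: lin0_def vec_eq_iff mat_def forall_3 pderiv3_X pderiv3_Y1 pderiv3_Y2 coef3_one)

lemma comp_map_Diff_fib: "F \<in> Diff_fib \<Longrightarrow> G \<in> Diff_fib \<Longrightarrow> comp_map F G \<in> Diff_fib"
  by (simp add: Diff_fib_iff lin0_comp_map invertible_mult subst3_X)

text \<open>The formal inverse function theorem. With A the linear part and \<open>H\<close> the
  remainder of order 2, a right inverse solves \<open>\<Psi>\<close> = A^-1 (id - \<open>H\<close> o
  \<open>\<Psi>\<close>), whose right-hand side raises degrees by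
  \<open>order_ge_subst3_diff'\<close>.\<close>

lemma Diff_right_inverse:
  assumes "\<Phi> \<in> Diff"
  obtains \<Psi> where "\<Psi> \<in> Diff" "comp_map \<Phi> \<Psi> = id_map"
proof -
  have van: "vanishing \<Phi>" and "invertible (lin0 \<Phi>)" using assms by (auto simp: Diff_iff)
  then obtain B where AB: "lin0 \<Phi> ** B = mat 1" and BA: "B ** lin0 \<Phi> = mat 1"
    by (auto simp: invertible_def)
  let ?A = "lin0 \<Phi>"
  define H where "H = (\<chi> l. \<Phi> $ l - (\<Sum>m\<in>UNIV. const3 (?A $ l $ m) * id_map $ m))"
  have H2: "order_ge 2 (H $ l)" for l
    unfolding order_ge_def
  proof (intro allI impI)
    fix i j k :: nat assume "i + j + k < 2"
    then have "(i = 0 \<and> j = 0 \<and> k = 0) \<or> (i = 1 \<and> j = 0 \<and> k = 0) \<or> (i = 0 \<and> j = 1 \<and> k = 0)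
       \<or> (i = 0 \<and> j = 0 \<and> k = 1)" by linarith
    then show "coef3 (H $ l) i j k = 0"
      using order_geD[OF vanishingD[OF van], of 0 0 0]
      by (auto simp: H_def lin0_def sum_3 coef3_X coef3_Y1 coef3_Y2 coef3_pderiv3)
  qed
  define T where "T \<Psi> = (\<chi> m. \<Sum>s\<in>UNIV. const3 (B $ m $ s) * (id_map $ s - subst3 (H $ s) \<Psi>))" for \<Psi>
  have "order_ge 1 (T F $ m)" if "\<And>m. order_ge 1 (F $ m)" for F m
  proof -
    have "vanishing F" using that by (simp add: vanishing_def)
    then show ?thesis unfolding T_def
      by (auto intro!: order_ge_sum order_ge_multR order_ge_diff order_ge_subst3
          order_ge_antimono[OF H2] simp: vanishingD[OF vanishing_id_map])
  qed
  moreover have "order_ge (Suc n) (T F $ m - T G $ m)"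
    if "\<And>m. order_ge 1 (F $ m)" "\<And>m. order_ge 1 (G $ m)" "\<And>m. order_ge n (F $ m - G $ m)" for n F G m
  proof -
    have *: "T F $ m - T G $ m = (\<Sum>s\<in>UNIV. const3 (B $ m $ s) * (subst3 (H $ s) G - subst3 (H $ s) F))"
      unfolding T_def by (simp add: algebra_simps flip: sum_subtractf)
    have "vanishing F" "vanishing G" "order_ge n (G $ m - F $ m)" for m
      using that order_ge_uminus[OF that(3), of m] by (auto simp: vanishing_def)
    then show ?thesis unfolding *
      by (intro order_ge_sum order_ge_multR order_ge_subst3_diff' H2)
  qed
  ultimately obtain \<Psi> where 1: "\<And>m. order_ge 1 (\<Psi> $ m)" and T\<Psi>: "T \<Psi> = \<Psi>"
    using causal_fixpoint[of 1 T] by blast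
  then have v: "vanishing \<Psi>" by (simp add: vanishing_def)
  have id: "comp_map \<Phi> \<Psi> = id_map"
  proof (rule vec_eq_iff[THEN iffD2], rule allI)
    fix l
    have "subst3 (\<Phi> $ l) \<Psi> = subst3 (H $ l) \<Psi> + (\<Sum>m\<in>UNIV. const3 (?A $ l $ m) * subst3 (id_map $ m) \<Psi>)"
      by (simp add: H_def subst3_diff subst3_sum subst3_const3_mult)
    also have "(\<Sum>m\<in>UNIV. const3 (?A $ l $ m) * subst3 (id_map $ m) \<Psi>)
        = (\<Sum>m\<in>UNIV. const3 (?A $ l $ m) * \<Psi> $ m)"
      by (simp add: sum_3 subst3_X subst3_Y1 subst3_Y2 v)
    also have "\<dots> = (\<Sum>m\<in>UNIV. const3 (?A $ l $ m) * T \<Psi> $ m)"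
      by (simp add: T\<Psi>)
    also have "\<dots> = (\<Sum>m\<in>UNIV. \<Sum>s\<in>UNIV. const3 (?A $ l $ m * B $ m $ s) * (id_map $ s - subst3 (H $ s) \<Psi>))"
      by (simp add: T_def sum_distrib_left const3_mult mult.assoc)
    also have "\<dots> = (\<Sum>s\<in>UNIV. const3 ((?A ** B) $ l $ s) * (id_map $ s - subst3 (H $ s) \<Psi>))"
      by (subst sum.swap) (simp add: matrix_matrix_mult_def const3_sum sum_distrib_right)
    also have "\<dots> = id_map $ l - subst3 (H $ l) \<Psi>"
      by (simp add: AB mat_def if_distrib[of const3] if_distrib[of "\<lambda>x. x * _"] cong: if_cong)
    finally show "comp_map \<Phi> \<Psi> $ l = id_map $ l" by simp
  qed
  then have "?A ** lin0 \<Psi> = mat 1"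
    using lin0_comp_map[OF v, of \<Phi>] by simp
  then have "invertible (lin0 \<Psi>)"
    using invertible_left_inverse by blast
  then show ?thesis using that[of \<Psi>] v id by (simp add: Diff_iff)
qed

text \<open>The right inverse has a right inverse in turn, which associativity identifies with
  \<open>\<Phi>\<close>.\<close>

lemma Diff_inverse:
  assumes "\<Phi> \<in> Diff"
  obtains \<Psi> where "\<Psi> \<in> Diff" "comp_map \<Phi> \<Psi> = id_map" "comp_map \<Psi> \<Phi> = id_map"
proof -
  obtain \<Psi> where \<Psi>: "\<Psi> \<in> Diff" "comp_map \<Phi> \<Psi> = id_map" using assms by (rule Diff_right_inverse)
  obtain \<Theta> where \<Theta>: "\<Theta> \<in> Diff" "comp_map \<Psi> \<Theta> = id_map" using \<Psi>(1) by (rule Diff_right_inverse)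
  have "\<Phi> = comp_map (comp_map \<Phi> \<Psi>) \<Theta>"
    using assms \<Psi> \<Theta> by (subst comp_map_assoc) (auto simp: Diff_iff)
  then have "\<Phi> = \<Theta>" using \<Psi> \<Theta> by (simp add: Diff_iff)
  then show ?thesis using that \<Psi> \<Theta> by blast
qed

lemma inv_map:
  assumes "\<Phi> \<in> Diff"
  shows "inv_map \<Phi> \<in> Diff" "comp_map \<Phi> (inv_map \<Phi>) = id_map" "comp_map (inv_map \<Phi>) \<Phi> = id_map"
proof -
  let ?P = "\<lambda>\<Psi>. \<Psi> \<in> Diff \<and> comp_map \<Phi> \<Psi> = id_map \<and> comp_map \<Psi> \<Phi> = id_map"
  have "\<exists>!\<Psi>. ?P \<Psi>"
  proof (rule ex_ex1I)
    show "\<exists>\<Psi>. ?P \<Psi>" using Diff_inverse[OF assms] by blast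
    fix \<Psi> \<Theta> assume *: "?P \<Psi>" "?P \<Theta>"
    have "comp_map (comp_map \<Psi> \<Phi>) \<Theta> = comp_map \<Psi> (comp_map \<Phi> \<Theta>)"
      using assms * by (intro comp_map_assoc) (auto simp: Diff_iff)
    then show "\<Psi> = \<Theta>" using * by (simp add: Diff_iff)
  qed
  from theI'[OF this] show "inv_map \<Phi> \<in> Diff" "comp_map \<Phi> (inv_map \<Phi>) = id_map"
    "comp_map (inv_map \<Phi>) \<Phi> = id_map"
    by (simp_all add: inv_map_def)
qed

lemma inv_map_Diff_fib:
  assumes "\<Phi> \<in> Diff_fib"
  shows "inv_map \<Phi> \<in> Diff_fib"
proof -
  have \<Phi>: "\<Phi> \<in> Diff" "\<Phi> $ 1 = X" using assms by (auto simp: Diff_fib_def)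
  note inv = inv_map[OF this(1)]
  have "subst3 (\<Phi> $ 1) (inv_map \<Phi>) = X"
    using arg_cong[OF inv(2), of "\<lambda>F. F $ 1"] by simp
  then show ?thesis using inv(1) \<Phi> by (simp add: Diff_fib_def Diff_iff subst3_X)
qed

subsection \<open>Conjugacy of formal vector fields\<close>

text \<open>Writing the conjugacy equation without the inverse map lets it be checked directly on
  solutions of fixed-point equations; \<open>conjugates_iff_push_forward\<close> links it to
  \<open>push_forward\<close>.\<close>

definition conjugates :: "fps3 ^ 3 \<Rightarrow> fps3 ^ 3 \<Rightarrow> fps3 ^ 3 \<Rightarrow> bool" where
  "conjugates \<Phi> Y Z \<longleftrightarrow> \<Phi> \<in> Diff_fib \<and> jacobian \<Phi> *v Y = comp_map Z \<Phi>"

lemma jacobian_mult_nth: "(jacobian \<Phi> *v Y) $ l = (\<Sum>m\<in>UNIV. pderiv3 m (\<Phi> $ l) * Y $ m)"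
  by (simp add: matrix_vector_mult_def jacobian_nth)

lemma conjugates_iff_push_forward:
  "conjugates \<Phi> Y Z \<longleftrightarrow> \<Phi> \<in> Diff_fib \<and> push_forward \<Phi> Y = Z"
proof (cases "\<Phi> \<in> Diff_fib")
  case True
  then have \<Phi>: "\<Phi> \<in> Diff" by (simp add: Diff_fib_def)
  note inv = inv_map[OF this]
  have van: "vanishing \<Phi>" "vanishing (inv_map \<Phi>)" using \<Phi> inv by (auto simp: Diff_iff)
  show ?thesis unfolding conjugates_def push_forward_def
    using van by (auto simp: True comp_map_assoc inv)
qed (simp add: conjugates_def)

text \<open>The chain rule, brought to the same shape as \<open>comp_map_jacobian_mult\<close>: the
  two right-hand sides agree as soon as \<open>\<Phi>\<close> conjugates \<open>Y\<close> to
  \<open>Z\<close>.\<close>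

lemma jacobian_comp_map_mult:
  assumes "vanishing \<Phi>"
  shows "jacobian (comp_map \<Psi> \<Phi>) *v Y =
    (\<chi> l. \<Sum>s\<in>UNIV. subst3 (pderiv3 s (\<Psi> $ l)) \<Phi> * (jacobian \<Phi> *v Y) $ s)"
proof -
  have "(\<Sum>m\<in>UNIV. (\<Sum>s\<in>UNIV. subst3 (pderiv3 s (\<Psi> $ l)) \<Phi> * pderiv3 m (\<Phi> $ s)) * Y $ m)
     = (\<Sum>s\<in>UNIV. subst3 (pderiv3 s (\<Psi> $ l)) \<Phi> * (\<Sum>m\<in>UNIV. pderiv3 m (\<Phi> $ s) * Y $ m))" for l
    unfolding sum_distrib_left sum_distrib_right by (subst sum.swap) (simp add: mult.assoc)
  then show ?thesis
    by (simp add: vec_eq_iff jacobian_mult_nth pderiv3_subst3 assms)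
qed

lemma comp_map_jacobian_mult:
  assumes "vanishing \<Phi>"
  shows "comp_map (jacobian \<Psi> *v Z) \<Phi> =
    (\<chi> l. \<Sum>s\<in>UNIV. subst3 (pderiv3 s (\<Psi> $ l)) \<Phi> * comp_map Z \<Phi> $ s)"
  by (simp add: vec_eq_iff jacobian_mult_nth subst3_sum subst3_mult assms)

lemma conjugates_trans:
  assumes "conjugates \<Phi> Y Z" "conjugates \<Psi> Z W"
  shows "conjugates (comp_map \<Psi> \<Phi>) Y W"
proof -
  have van: "vanishing \<Phi>" "vanishing \<Psi>" using assms by (auto simp: conjugates_def Diff_fib_iff)
  have "jacobian (comp_map \<Psi> \<Phi>) *v Y = comp_map (jacobian \<Psi> *v Z) \<Phi>"
    using assms(1) by (simp add: jacobian_comp_map_mult comp_map_jacobian_mult van conjugates_def)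
  also have "\<dots> = comp_map W (comp_map \<Psi> \<Phi>)"
    using assms(2) van by (simp add: conjugates_def comp_map_assoc)
  finally show ?thesis using assms by (simp add: conjugates_def comp_map_Diff_fib)
qed

text \<open>Differentiate the identity (inverse of \<open>\<Phi>\<close>) o \<open>\<Phi>\<close> =
  id along \<open>Y\<close>, then compose with the inverse on the right.\<close>

lemma conjugates_inv_map:
  assumes "conjugates \<Phi> Y Z"
  shows "conjugates (inv_map \<Phi>) Z Y"
proof -
  have \<Phi>: "\<Phi> \<in> Diff_fib" "\<Phi> \<in> Diff" using assms by (auto simp: conjugates_def Diff_fib_def)
  note inv = inv_map[OF this(2)]
  have van: "vanishing \<Phi>" "vanishing (inv_map \<Phi>)" using \<Phi> inv by (auto simp: Diff_iff)
  have "Y = jacobian (comp_map (inv_map \<Phi>) \<Phi>) *v Y"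
    by (simp add: inv vec_eq_iff jacobian_mult_nth forall_3 sum_3 pderiv3_X pderiv3_Y1 pderiv3_Y2)
  also have "\<dots> = comp_map (jacobian (inv_map \<Phi>) *v Z) \<Phi>"
    using assms by (simp add: jacobian_comp_map_mult comp_map_jacobian_mult van conjugates_def)
  finally have "comp_map Y (inv_map \<Phi>) = jacobian (inv_map \<Phi>) *v Z"
    by (metis comp_map_assoc comp_map_id_right inv(2) van)
  then show ?thesis using inv_map_Diff_fib[OF \<Phi>(1)] by (simp add: conjugates_def)
qed

subsection \<open>Removing the non-resonant terms\<close>

text \<open>
  The terms with \<open>d = -1\<close> and \<open>d = 1\<close> are the resonant ones of the components along \<open>y1\<close> and \<open>y2\<close>.
\<close>

definition resonant :: "int \<Rightarrow> fps3 \<Rightarrow> fps3" where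
  "resonant d F = Abs_fps3 (\<lambda>i j k. if int k - int j = d then coef3 F i j k else 0)"

text \<open>The linear part of a prepared vector field divided by l. The monomial x^i y1^j y2^k is
  an eigenvector with eigenvalue k - j, so the kernel consists of the series in x and v = y1
  y2.\<close>

definition delta :: "fps3 \<Rightarrow> fps3" where
  "delta F = Y2 * pderiv3 3 F - Y1 * pderiv3 2 F"

lemma coef3_resonant: "coef3 (resonant d F) i j k = (if int k - int j = d then coef3 F i j k else 0)"
  by (simp add: resonant_def)

lemma resonant_diff: "resonant d (F - G) = resonant d F - resonant d G"
  by (rule fps3_eqI) (simp add: coef3_resonant)

lemma resonant_idem [simp]: "resonant d (resonant d F) = resonant d F"
  by (rule fps3_eqI) (simp add: coef3_resonant)

lemma order_ge_resonant: "order_ge n F \<Longrightarrow> order_ge n (resonant d F)"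
  by (simp add: order_ge_def coef3_resonant)

lemma coef3_Y1_pderiv3: "coef3 (Y1 * pderiv3 2 F) i j k = of_nat j * coef3 F i j k"
  and coef3_Y2_pderiv3: "coef3 (Y2 * pderiv3 3 F) i j k = of_nat k * coef3 F i j k"
  and coef3_X_pderiv3: "coef3 (X * pderiv3 1 F) i j k = of_nat i * coef3 F i j k"
  by (simp_all add: coef3_Y1_mult coef3_Y2_mult coef3_X_mult coef3_pderiv3 del: of_nat_add)

lemma coef3_delta: "coef3 (delta F) i j k = of_int (int k - int j) * coef3 F i j k"
  by (simp add: delta_def coef3_Y1_pderiv3 coef3_Y2_pderiv3 left_diff_distrib)

lemma delta_eq_0_iff: "delta F = 0 \<longleftrightarrow> (\<forall>i j k. j \<noteq> k \<longrightarrow> coef3 F i j k = 0)"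
proof
  assume "delta F = 0"
  then have "of_int (int k - int j) * coef3 F i j k = 0" for i j k
    by (metis coef3_delta coef3_zero)
  then show "\<forall>i j k. j \<noteq> k \<longrightarrow> coef3 F i j k = 0"
    by (metis mult_eq_0_iff of_int_eq_0_iff of_nat_eq_iff right_minus_eq)
next
  assume "\<forall>i j k. j \<noteq> k \<longrightarrow> coef3 F i j k = 0"
  then have "coef3 (delta F) i j k = coef3 0 i j k" for i j k
    by (cases "j = k") (simp_all add: coef3_delta)
  then show "delta F = 0" by (rule fps3_eqI)
qed

lemma order_ge_pderiv3': "order_ge n F \<Longrightarrow> order_ge (n - 1) (pderiv3 m F)"
  by (cases n) (auto intro: order_ge_pderiv3)

lemma tangent_to_id_Diff_fib:
  assumes "order_ge 2 p1" "order_ge 2 p2"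
  shows "vector [X, Y1 + p1, Y2 + p2] \<in> Diff_fib"
proof -
  have 1: "order_ge 1 (pderiv3 m p1)" "order_ge 1 (pderiv3 m p2)" for m
    using order_ge_pderiv3'[OF assms(1)] order_ge_pderiv3'[OF assms(2)] by simp_all
  have "lin0 (vector [X, Y1 + p1, Y2 + p2]) = mat 1"
    using order_geD[OF 1(1), of 0 0 0] order_geD[OF 1(2), of 0 0 0]
    by (simp add: lin0_def vec_eq_iff mat_def forall_3 vector_3 pderiv3_add pderiv3_X pderiv3_Y1
        pderiv3_Y2 coef3_one)
  moreover have "vanishing (vector [X, Y1 + p1, Y2 + p2] :: fps3 ^ 3)"
    using assms[THEN order_ge_antimono, of 1]
    by (auto simp: vanishing_def forall_3 vector_3 intro!: order_ge_add)
  ultimately show ?thesis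
    by (auto simp: Diff_fib_iff vector_3 invertible_def intro!: exI[of _ "mat 1"])
qed

text \<open>For a map tangent to the identity with correction p, the conjugacy equation reads R + l
  (delta p - d p) = G in each component, with d = -1 or 1. The operator on p multiplies a monomial
  by l (k - j - d), which is zero exactly on resonant terms: these go to R, all others to p. The two
  preserved coefficients are those that give the residue.\<close>

lemma poincare_dulac:
  assumes "l \<noteq> 0" and F: "order_ge 2 F1" "order_ge 2 F2"
  obtains \<Psi> R1 R2 where "order_ge 2 R1" "order_ge 2 R2" "resonant (-1) R1 = R1" "resonant 1 R2 = R2"
    "coef3 R1 1 1 0 = coef3 F1 1 1 0" "coef3 R2 1 0 1 = coef3 F2 1 0 1"
    "conjugates \<Psi> (vector [X ^ 2, - const3 l * Y1 + R1, const3 l * Y2 + R2])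
       (vector [X ^ 2, - const3 l * Y1 + F1, const3 l * Y2 + F2])"
proof -
  \<comment> \<open>One unknown \<open>Q\<close> per component: its resonant part is the term of the new vector field, the rest
    is the term of the conjugation.\<close>
  define F :: "fps3 ^ 2" where "F = vector [F1, F2]"
  define d :: "2 \<Rightarrow> int" where "d m = (if m = 1 then - 1 else 1)" for m
  define R :: "fps3 ^ 2 \<Rightarrow> 2 \<Rightarrow> fps3" where "R Q m = resonant (d m) (Q $ m)" for Q m
  define p :: "fps3 ^ 2 \<Rightarrow> 2 \<Rightarrow> fps3" where "p Q m = Q $ m - R Q m" for Q m
  define \<Psi> :: "fps3 ^ 2 \<Rightarrow> fps3 ^ 3" where "\<Psi> Q = vector [X, Y1 + p Q 1, Y2 + p Q 2]" for Q
  \<comment> \<open>What remains of the conjugacy equation once the linear terms are moved to the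
    other side.\<close>
  define G :: "fps3 ^ 2 \<Rightarrow> 2 \<Rightarrow> fps3" where "G Q m = subst3 (F $ m) (\<Psi> Q) - X ^ 2 * pderiv3 1 (p Q m)
    - R Q 1 * pderiv3 2 (p Q m) - R Q 2 * pderiv3 3 (p Q m)" for Q m
  \<comment> \<open>The divisor 1 in resonant places makes \<open>Q\<close> carry the coefficient of
    \<open>G\<close> there; everywhere else the divisor is nonzero because l is.\<close>
  define T :: "fps3 ^ 2 \<Rightarrow> fps3 ^ 2" where "T Q = (\<chi> m. Abs_fps3 (\<lambda>i j k. coef3 (G Q m) i j k /
      (if int k - int j = d m then 1 else l * of_int (int k - int j - d m))))" for Q
  have F2: "order_ge 2 (F $ m)" for m
    using exhaust_2[of m] assms by (auto simp: F_def)
  have XX: "order_ge 2 (X ^ 2)" using order_ge_power[of X 2] by simp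
  have Rp: "order_ge n (R Q m)" "order_ge n (p Q m)" if "\<And>m. order_ge n (Q $ m)" for n Q m
    using that by (auto simp: R_def p_def intro!: order_ge_resonant order_ge_diff)
  have R_diff: "R Q m - R Q' m = R (Q - Q') m" and p_diff: "p Q m - p Q' m = p (Q - Q') m" for Q Q' m
    by (simp_all add: R_def p_def resonant_diff)
  have \<Psi>: "\<Psi> Q \<in> Diff_fib" "vanishing (\<Psi> Q)" if "\<And>m. order_ge 2 (Q $ m)" for Q
    using tangent_to_id_Diff_fib[OF Rp(2)[OF that] Rp(2)[OF that], of 1 2]
    by (auto simp: \<Psi>_def Diff_fib_iff)
  have dp: "order_ge (n - 1) (pderiv3 s (p Q m))" if "\<And>m. order_ge n (Q $ m)" for Q m s n
    using Rp(2)[OF that] by (rule order_ge_pderiv3')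
  have dp2: "order_ge 1 (pderiv3 s (p Q m))" if "\<And>m. order_ge 2 (Q $ m)" for Q m s
    using dp[OF that] by simp
  have G2: "order_ge 2 (G Q m)" if Q: "\<And>m. order_ge 2 (Q $ m)" for Q m
    unfolding G_def
    by (intro order_ge_diff order_ge_subst3 order_ge_multL Rp \<Psi> XX F2 Q)
  have "order_ge 2 (T Q $ m)" if Q: "\<And>m. order_ge 2 (Q $ m)" for Q m
    using G2[OF that] by (simp add: T_def order_ge_def)
  moreover have "order_ge (Suc n) (T Q $ m - T Q' $ m)"
    if Q: "\<And>m. order_ge 2 (Q $ m)" and Q': "\<And>m. order_ge 2 (Q' $ m)"
      and QQ: "\<And>m. order_ge n (Q $ m - Q' $ m)" for n Q Q' m
  proof -
    have QQ': "order_ge n ((Q - Q') $ m)" for m using QQ by simp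
    have \<Psi>d: "order_ge n (\<Psi> Q $ m - \<Psi> Q' $ m)" for m
      using exhaust_3[of m] Rp(2)[OF QQ'] by (auto simp: \<Psi>_def vector_3 p_diff)
    have dpd: "order_ge (n - 1) (pderiv3 s (p Q m) - pderiv3 s (p Q' m))" for s
      using dp[OF QQ'] by (simp add: p_diff flip: pderiv3_diff)
    \<comment> \<open>The degree lost by differentiating the difference is recovered, with one to
      spare, from the order 2 of \<open>R Q' t\<close>.\<close>
    have RR: "order_ge (Suc n) (R Q t * pderiv3 s (p Q m) - R Q' t * pderiv3 s (p Q' m))" for t s
      using Rp(1)[OF QQ', of t]
      by (intro order_ge_mult_diff[OF _ dp2[OF Q] Rp(1)[OF Q'] dpd]) (auto simp: R_diff)
    have "order_ge (Suc n) (X ^ 2 * (pderiv3 1 (p Q m) - pderiv3 1 (p Q' m)))"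
      by (rule order_ge_mult'[OF XX dpd]) simp
    moreover have "G Q m - G Q' m = (subst3 (F $ m) (\<Psi> Q) - subst3 (F $ m) (\<Psi> Q'))
      - X ^ 2 * (pderiv3 1 (p Q m) - pderiv3 1 (p Q' m))
      - (R Q 1 * pderiv3 2 (p Q m) - R Q' 1 * pderiv3 2 (p Q' m))
      - (R Q 2 * pderiv3 3 (p Q m) - R Q' 2 * pderiv3 3 (p Q' m))"
      unfolding G_def by (simp add: algebra_simps)
    ultimately have "order_ge (Suc n) (G Q m - G Q' m)"
      using order_ge_subst3_diff'[OF \<Psi>(2)[OF Q] \<Psi>(2)[OF Q'] \<Psi>d F2[of m]] RR[of 1 2] RR[of 2 3]
      by (metis order_ge_diff)
    then show ?thesis
      by (simp add: T_def order_ge_def flip: diff_divide_distrib)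
  qed
  ultimately obtain Q where Q: "\<And>m. order_ge 2 (Q $ m)" and TQ: "T Q = Q"
    using causal_fixpoint[of 2 T] by blast
  have eq: "R Q m + const3 l * (delta (p Q m) - const3 (of_int (d m)) * p Q m) = G Q m" for m
  proof (rule fps3_eqI)
    fix i j k
    have "coef3 (Q $ m) i j k = coef3 (T Q $ m) i j k" by (simp add: TQ)
    then have *: "coef3 (Q $ m) i j k = coef3 (G Q m) i j k /
      (if int k - int j = d m then 1 else l * of_int (int k - int j - d m))"
      by (simp add: T_def)
    show "coef3 (R Q m + const3 l * (delta (p Q m) - const3 (of_int (d m)) * p Q m)) i j k = coef3 (G Q m) i j k"
    proof (cases "int k - int j = d m")
      case True
      then show ?thesis using * by (simp add: R_def p_def coef3_resonant coef3_delta)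
    next
      case False
      define t :: complex where "t = l * of_int (int k - int j - d m)"
      have "t \<noteq> 0" using False \<open>l \<noteq> 0\<close> by (simp add: t_def del: of_int_diff)
      moreover have "coef3 (Q $ m) i j k = coef3 (G Q m) i j k / t"
        using * False by (simp add: t_def)
      ultimately have "coef3 (G Q m) i j k = l * of_int (int k - int j - d m) * coef3 (Q $ m) i j k"
        by (simp add: t_def del: of_int_diff)
      then show ?thesis using False
        by (simp add: R_def p_def coef3_resonant coef3_delta) (simp add: algebra_simps)
    qed
  qed
  let ?N = "vector [X ^ 2, - const3 l * Y1 + R Q 1, const3 l * Y2 + R Q 2] :: fps3 ^ 3"
  let ?Z = "vector [X ^ 2, - const3 l * Y1 + F1, const3 l * Y2 + F2] :: fps3 ^ 3"
  have "jacobian (\<Psi> Q) *v ?N = comp_map ?Z (\<Psi> Q)"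
  proof -
    have e1: "R Q 1 + const3 l * (delta (p Q 1) + p Q 1) = G Q 1"
      and e2: "R Q 2 + const3 l * (delta (p Q 2) - p Q 2) = G Q 2"
      using eq[of 1] eq[of 2] by (simp_all add: d_def const3_minus)
    have "X ^ 2 * pderiv3 1 (p Q 1) + (- const3 l * Y1 + R Q 1) * (1 + pderiv3 2 (p Q 1))
        + (const3 l * Y2 + R Q 2) * pderiv3 3 (p Q 1)
        = - const3 l * (Y1 + p Q 1) + subst3 F1 (\<Psi> Q)"
      using e1 unfolding delta_def G_def by (simp add: F_def algebra_simps)
    moreover have "X ^ 2 * pderiv3 1 (p Q 2) + (- const3 l * Y1 + R Q 1) * pderiv3 2 (p Q 2)
        + (const3 l * Y2 + R Q 2) * (1 + pderiv3 3 (p Q 2))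
        = const3 l * (Y2 + p Q 2) + subst3 F2 (\<Psi> Q)"
      using e2 unfolding delta_def G_def by (simp add: F_def algebra_simps)
    ultimately show ?thesis
      using \<Psi>(2)[OF Q]
      by (simp add: vec_eq_iff forall_3 jacobian_mult_nth sum_3 subst3_add subst3_diff subst3_uminus subst3_power subst3_X
          subst3_Y1 subst3_Y2 subst3_const3_mult pderiv3_add pderiv3_X pderiv3_Y1 pderiv3_Y2 subst3_mult)
         (simp add: \<Psi>_def vector_3 pderiv3_add pderiv3_X pderiv3_Y1 pderiv3_Y2 algebra_simps)
  qed
  then have conj: "conjugates (\<Psi> Q) ?N ?Z" using \<Psi>(1)[OF Q] by (simp add: conjugates_def)
  \<comment> \<open>The map differs from the identity in order 2 and \<open>F\<close> starts in
    degree 2, so \<open>G\<close> and \<open>F\<close> have the same quadratic terms. This preserves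
    the coefficients of x y1 and x y2.\<close>
  have G3: "order_ge 3 (G Q m - F $ m)" for m
  proof -
    have "order_ge 2 (\<Psi> Q $ m - id_map $ m)" for m
      using exhaust_3[of m] Rp(2)[OF Q] by (auto simp: \<Psi>_def vector_3)
    from order_ge_subst3_diff'[OF \<Psi>(2)[OF Q] vanishing_id_map this F2[of m]]
    have "order_ge 3 (subst3 (F $ m) (\<Psi> Q) - F $ m)" by simp
    moreover have "order_ge 3 (X ^ 2 * pderiv3 1 (p Q m))" "order_ge 3 (R Q t * pderiv3 s (p Q m))" for t s
      by (rule order_ge_mult'[OF XX dp2[OF Q]] order_ge_mult'[OF Rp(1)[OF Q] dp2[OF Q]]; simp)+
    moreover have "G Q m - F $ m = (subst3 (F $ m) (\<Psi> Q) - F $ m) - X ^ 2 * pderiv3 1 (p Q m)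
      - R Q 1 * pderiv3 2 (p Q m) - R Q 2 * pderiv3 3 (p Q m)"
      unfolding G_def by simp
    ultimately show ?thesis by (metis order_ge_diff)
  qed
  have "coef3 (T Q $ 1) 1 1 0 = coef3 F1 1 1 0" "coef3 (T Q $ 2) 1 0 1 = coef3 F2 1 0 1"
    using order_geD[OF G3[of 1], of 1 1 0] order_geD[OF G3[of 2], of 1 0 1]
    by (simp_all add: T_def d_def F_def)
  then have "coef3 (R Q 1) 1 1 0 = coef3 F1 1 1 0" "coef3 (R Q 2) 1 0 1 = coef3 F2 1 0 1"
    by (simp_all add: TQ R_def d_def coef3_resonant)
  moreover have "resonant (-1) (R Q 1) = R Q 1" "resonant 1 (R Q 2) = R Q 2"
    by (simp_all add: R_def d_def)
  ultimately show ?thesis using that Rp(1)[OF Q] conj by blast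
qed

subsection \<open>Normalising the resonant terms\<close>

lemma delta_mult: "delta (F * G) = F * delta G + delta F * G"
  and delta_add: "delta (F + G) = delta F + delta G"
  and delta_diff: "delta (F - G) = delta F - delta G"
  and delta_one [simp]: "delta 1 = 0"
  and delta_X [simp]: "delta X = 0" and delta_Y1: "delta Y1 = - Y1" and delta_Y2: "delta Y2 = Y2"
proof -
  show "delta 1 = 0" using pderiv3_const3[of _ 1] by (simp add: delta_def)
qed (simp_all add: delta_def pderiv3_mult pderiv3_add pderiv3_diff pderiv3_X pderiv3_Y1 pderiv3_Y2
    algebra_simps)

lemma delta_subst3:
  assumes "vanishing G"
  shows "delta (subst3 F G) = (\<Sum>l\<in>UNIV. subst3 (pderiv3 l F) G * delta (G $ l))"
  by (simp add: delta_def pderiv3_subst3[OF assms] sum_distrib_left right_diff_distrib mult_ac sum_subtractf)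

text \<open>The components of \<open>G\<close> have the weights 0, -1, 1 of x, y1, y2, so
  substituting \<open>G\<close> commutes with \<open>delta\<close>.\<close>

lemma delta_subst3_eq_0:
  assumes "vanishing G" "delta F = 0" "delta (G $ 1) = 0" "delta (G $ 2) = - G $ 2" "delta (G $ 3) = G $ 3"
  shows "delta (subst3 F G) = 0"
proof -
  have "delta (subst3 F G) = subst3 (delta F) G"
    by (simp add: delta_subst3 assms(1,3-) sum_3)
       (simp add: delta_def subst3_diff subst3_var_mult assms(1) mult_ac)
  then show ?thesis by (simp add: assms)
qed

text \<open>On series in x and v the normal form acts as x^2 d/dx + ((a1 + a2) x + c1 + c2) v d/dv,
  since -l and l cancel. For the map (x, y1 (1 + e1), y2 (1 + e2)) the conjugacy equation, divided
  by y1 or y2, has the main part x (x d/dx + (a1 + a2) v d/dv) e + c. It acts on x^i v^k in e with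
  the divisor i + (a1 + a2) k, while c takes up the terms free of x.\<close>

lemma resonant_normalisation:
  assumes Q: "order_ge 2 Q1" "order_ge 2 Q2" "delta Q1 = 0" "delta Q2 = 0"
    and nd: "\<And>i k. (i, k) \<noteq> (0, 0) \<Longrightarrow> of_nat i + (a1 + a2) * of_nat k \<noteq> 0"
  obtains \<Psi> c1 c2 where "fps_nth c1 0 = 0" "fps_nth c2 0 = 0"
    "conjugates \<Psi> (normal_form l a1 a2 c1 c2)
       (vector [X ^ 2, (- const3 l + const3 a1 * X + Q1) * Y1, (const3 l + const3 a2 * X + Q2) * Y2])"
proof -
  \<comment> \<open>The unknown is \<open>W = C + X e\<close>, with \<open>C\<close> free of \<open>x\<close>; the shift by \<open>X\<close> makes the operator raise
    degrees although \<open>e\<close> is determined by the equation one degree higher.\<close>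
  define Q :: "fps3 ^ 2" where "Q = vector [Q1, Q2]"
  define e :: "fps3 ^ 2 \<Rightarrow> 2 \<Rightarrow> fps3"
    where "e W m = Abs_fps3 (\<lambda>i j k. coef3 (W $ m) (Suc i) j k)" for W m
  define C :: "fps3 ^ 2 \<Rightarrow> 2 \<Rightarrow> fps3"
    where "C W m = Abs_fps3 (\<lambda>i j k. if i = 0 then coef3 (W $ m) 0 j k else 0)" for W m
  define \<Psi> :: "fps3 ^ 2 \<Rightarrow> fps3 ^ 3" where "\<Psi> W = vector [X, Y1 + Y1 * e W 1, Y2 + Y2 * e W 2]" for W
  \<comment> \<open>On series in x and v, \<open>Y1 * pderiv3 2\<close> is the operator v
    d/dv.\<close>
  define G :: "fps3 ^ 2 \<Rightarrow> 2 \<Rightarrow> fps3" where "G W m = subst3 (Q $ m) (\<Psi> W) * (1 + e W m)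
    - C W m * e W m - (C W 1 + C W 2) * (Y1 * pderiv3 2 (e W m))" for W m
  \<comment> \<open>The entry of \<open>W\<close> at x^i is that of e at x^(i-1), whence i - 1 in
    the divisor. At i = 1, k = 0 the divisor is 0 and the quotient is 0 by convention, which is
    consistent because \<open>G\<close> has no linear terms. Zeros for j different from k keep the
    unknown in the kernel of \<open>delta\<close>.\<close>
  define T :: "fps3 ^ 2 \<Rightarrow> fps3 ^ 2" where "T W = (\<chi> m. Abs_fps3 (\<lambda>i j k. if j \<noteq> k then 0 else
      if i = 0 then coef3 (G W m) 0 j k else
      coef3 (G W m) i j k / (of_nat (i - 1) + (a1 + a2) * of_nat k)))" for W
  have Q2: "order_ge 2 (Q $ m)" and dQ: "delta (Q $ m) = 0" for m
    using exhaust_2[of m] Q by (auto simp: Q_def)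
  have C_ord: "order_ge n (C W m)" and e_ord: "order_ge (n - 1) (e W m)"
    if "\<And>m. order_ge n (W $ m)" for n W m
    using that[of m] by (auto simp: C_def e_def order_ge_def)
  have e1: "order_ge 1 (e W m)" if "\<And>m. order_ge 2 (W $ m)" for W m
    using e_ord[OF that] by simp
  have C_diff: "C W m - C W' m = C (W - W') m" and e_diff: "e W m - e W' m = e (W - W') m" for W W' m
    by (auto simp: C_def e_def intro!: fps3_eqI)
  have \<theta>_ord: "order_ge n (Y1 * pderiv3 2 F)" if "order_ge n F" for n F
    using that by (simp add: order_ge_def coef3_Y1_pderiv3)
  have \<Psi>: "\<Psi> W \<in> Diff_fib" "vanishing (\<Psi> W)" if W: "\<And>m. order_ge 2 (W $ m)" for W
  proof -
    have "order_ge 2 (Y1 * e W 1)" "order_ge 2 (Y2 * e W 2)"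
      by (rule order_ge_mult'[OF _ e1[OF W], where m = 1]; simp)+
    from tangent_to_id_Diff_fib[OF this] show "\<Psi> W \<in> Diff_fib" "vanishing (\<Psi> W)"
      by (simp_all add: \<Psi>_def Diff_fib_iff)
  qed
  have G2: "order_ge 2 (G W m)" if W: "\<And>m. order_ge 2 (W $ m)" for W m
    unfolding G_def
    by (intro order_ge_diff order_ge_add order_ge_multL order_ge_subst3 C_ord \<Psi> Q2 W)
  have "order_ge 2 (T W $ m)" if W: "\<And>m. order_ge 2 (W $ m)" for W m
    using G2[OF W] by (simp add: T_def order_ge_def)
  moreover have "order_ge (Suc n) (T W $ m - T W' $ m)"
    if W: "\<And>m. order_ge 2 (W $ m)" and W': "\<And>m. order_ge 2 (W' $ m)"
      and WW: "\<And>m. order_ge n (W $ m - W' $ m)" for n W W' m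
  proof -
    have WW': "order_ge n ((W - W') $ m)" for m using WW by simp
    have ed: "order_ge (n - 1) (e W m - e W' m)" and Cd: "order_ge n (C W m - C W' m)" for m
      using e_ord[OF WW'] C_ord[OF WW'] by (simp_all add: e_diff C_diff)
    have "order_ge n (Y1 * (e W 1 - e W' 1))" "order_ge n (Y2 * (e W 2 - e W' 2))"
      by (rule order_ge_mult'[OF _ ed, where m = 1]; simp)+
    then have \<Psi>d: "order_ge n (\<Psi> W $ m - \<Psi> W' $ m)" for m
      using exhaust_3[of m] by (auto simp: \<Psi>_def vector_3 right_diff_distrib)
    have "order_ge (Suc n) (subst3 (Q $ m) (\<Psi> W) - subst3 (Q $ m) (\<Psi> W'))"
      by (rule order_ge_subst3_diff'[OF \<Psi>(2)[OF W] \<Psi>(2)[OF W'] \<Psi>d Q2])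
    then have 1: "order_ge (Suc n) (subst3 (Q $ m) (\<Psi> W) * (1 + e W m) - subst3 (Q $ m) (\<Psi> W') * (1 + e W' m))"
      using ed[of m] order_ge_subst3[OF Q2 \<Psi>(2)[OF W']]
      by (intro order_ge_mult_diff[where a = "Suc n" and b = 0 and c = 2 and d = "n - 1"]) auto
    have 2: "order_ge (Suc n) (C W m * e W m - C W' m * e W' m)"
      by (rule order_ge_mult_diff[OF Cd e1[OF W] C_ord[OF W'] ed]) auto
    have "order_ge n ((C W 1 + C W 2) - (C W' 1 + C W' 2))"
      using order_ge_add[OF Cd[of 1] Cd[of 2]] by (simp add: algebra_simps)
    moreover have "order_ge (n - 1) (Y1 * pderiv3 2 (e W m) - Y1 * pderiv3 2 (e W' m))"
      using \<theta>_ord[OF ed] by (simp add: pderiv3_diff right_diff_distrib)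
    ultimately have 3: "order_ge (Suc n) ((C W 1 + C W 2) * (Y1 * pderiv3 2 (e W m))
        - (C W' 1 + C W' 2) * (Y1 * pderiv3 2 (e W' m)))"
      by (rule order_ge_mult_diff[OF _ \<theta>_ord[OF e1[OF W]] order_ge_add[OF C_ord[OF W'] C_ord[OF W']]]) auto
    have "G W m - G W' m =
      (subst3 (Q $ m) (\<Psi> W) * (1 + e W m) - subst3 (Q $ m) (\<Psi> W') * (1 + e W' m))
      - (C W m * e W m - C W' m * e W' m)
      - ((C W 1 + C W 2) * (Y1 * pderiv3 2 (e W m)) - (C W' 1 + C W' 2) * (Y1 * pderiv3 2 (e W' m)))"
      unfolding G_def by (simp add: algebra_simps)
    then have "order_ge (Suc n) (G W m - G W' m)"
      using 1 2 3 by (metis order_ge_diff)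
    then show ?thesis
      by (simp add: T_def order_ge_def flip: diff_divide_distrib)
  qed
  ultimately obtain W where W: "\<And>m. order_ge 2 (W $ m)" and TW: "T W = W"
    using causal_fixpoint[of 2 T] by blast
  note van = \<Psi>(2)[OF W]
  have coef_W: "coef3 (W $ m) i j k = (if j \<noteq> k then 0 else
      if i = 0 then coef3 (G W m) 0 j k else
      coef3 (G W m) i j k / (of_nat (i - 1) + (a1 + a2) * of_nat k))" for m i j k
    by (subst TW[symmetric]) (simp add: T_def)
  have de: "delta (e W m) = 0" and dC: "delta (C W m) = 0" for m
    unfolding delta_eq_0_iff by (auto simp: e_def C_def coef_W)
  have d\<Psi>: "delta (\<Psi> W $ 1) = 0" "delta (\<Psi> W $ 2) = - \<Psi> W $ 2" "delta (\<Psi> W $ 3) = \<Psi> W $ 3"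
    by (simp_all add: \<Psi>_def vector_3 delta_add delta_mult delta_Y1 delta_Y2 de)
  have \<theta>: "Y1 * pderiv3 2 (e W m) = Y2 * pderiv3 3 (e W m)" for m
    using de[of m] by (simp add: delta_def)
  have "delta (Y1 * pderiv3 2 (e W m)) = 0" for m
    using de[of m] by (auto simp: delta_eq_0_iff coef3_Y1_pderiv3)
  \<comment> \<open>\<open>G\<close> is built from series in x and v, so the equation holds
    trivially at the coefficients that \<open>T\<close> sets to zero.\<close>
  then have dG: "delta (G W m) = 0" for m
    unfolding G_def by (simp add: delta_diff delta_add delta_mult de dC delta_subst3_eq_0 van dQ d\<Psi>)
  have eq: "X * (X * pderiv3 1 (e W m) + const3 (a1 + a2) * (Y1 * pderiv3 2 (e W m))) + C W m = G W m" for m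
  proof (rule fps3_eqI)
    fix i j k
    have *: "of_nat i * coef3 (W $ m) (Suc i) k k + (a1 + a2) * (of_nat k * coef3 (W $ m) (Suc i) k k)
       = coef3 (G W m) (Suc i) k k" for i
    proof (cases "i = 0 \<and> k = 0")
      case True
      then show ?thesis using order_geD[OF G2[OF W], of 1 0 0 m] by simp
    next
      case False
      define s where "s = of_nat i + (a1 + a2) * of_nat k"
      have "s \<noteq> 0" using nd[of i k] False by (auto simp: s_def)
      moreover have "coef3 (W $ m) (Suc i) k k = coef3 (G W m) (Suc i) k k / s"
        by (simp add: coef_W s_def)
      ultimately have "s * coef3 (W $ m) (Suc i) k k = coef3 (G W m) (Suc i) k k" by simp
      then show ?thesis by (simp add: s_def distrib_right mult.assoc)
    qed
    show "coef3 (X * (X * pderiv3 1 (e W m) + const3 (a1 + a2) * (Y1 * pderiv3 2 (e W m))) + C W m) i j k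
        = coef3 (G W m) i j k"
    proof (cases "j = k")
      case True
      then show ?thesis using *
        by (cases i) (simp_all add: coef3_X_mult[of "_ + _"] coef3_X_pderiv3 coef3_Y1_pderiv3 e_def C_def coef_W[of _ 0])
    next
      case False
      then have "coef3 (G W m) i j k = 0" using dG[of m] by (simp add: delta_eq_0_iff)
      then show ?thesis using False
        by (simp add: coef3_X_mult[of "_ + _"] coef3_X_pderiv3 coef3_Y1_pderiv3 e_def C_def coef_W)
    qed
  qed
  define c where "c m = Abs_fps (\<lambda>k. coef3 (W $ m) 0 k k)" for m
  have c0: "fps_nth (c m) 0 = 0" for m
    using order_geD[OF W, of 0 0 0 m] by (simp add: c_def)
  have ev: "eval_v (c m) = C W m" for m
    by (rule fps3_eqI) (auto simp: coef3_eval_v c_def C_def coef_W)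
  let ?N = "normal_form l a1 a2 (c 1) (c 2)"
  let ?Z = "vector [X ^ 2, (- const3 l + const3 a1 * X + Q1) * Y1, (const3 l + const3 a2 * X + Q2) * Y2]"
  have "jacobian (\<Psi> W) *v ?N = comp_map ?Z (\<Psi> W)"
  proof -
    define L where "L = const3 l"
    define A1 where "A1 = const3 a1"
    define A2 where "A2 = const3 a2"
    have e1: "X * (X * pderiv3 1 (e W 1) + (A1 + A2) * (Y1 * pderiv3 2 (e W 1))) + C W 1
      = subst3 Q1 (\<Psi> W) * (1 + e W 1) - C W 1 * e W 1 - (C W 1 + C W 2) * (Y1 * pderiv3 2 (e W 1))"
      and e2: "X * (X * pderiv3 1 (e W 2) + (A1 + A2) * (Y1 * pderiv3 2 (e W 2))) + C W 2
      = subst3 Q2 (\<Psi> W) * (1 + e W 2) - C W 2 * e W 2 - (C W 1 + C W 2) * (Y1 * pderiv3 2 (e W 2))"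
      using eq[of 1] eq[of 2] by (simp_all add: G_def const3_add A1_def A2_def Q_def)
    \<comment> \<open>This is \<open>e1\<close> multiplied by \<open>Y1\<close>; the terms with
      \<open>L\<close> that multiply derivatives cancel by \<open>\<theta>\<close>.\<close>
    have 1: "Y1 * pderiv3 1 (e W 1) * X ^ 2 + (1 + (Y1 * pderiv3 2 (e W 1) + e W 1)) * ((- L + A1 * X + C W 1) * Y1)
        + Y1 * pderiv3 3 (e W 1) * ((L + A2 * X + C W 2) * Y2)
        = (- L + A1 * X + subst3 Q1 (\<Psi> W)) * (Y1 + Y1 * e W 1)"
      using e1 \<theta>[of 1] by algebra
    have 2: "Y2 * pderiv3 1 (e W 2) * X ^ 2 + Y2 * pderiv3 2 (e W 2) * ((- L + A1 * X + C W 1) * Y1)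
        + (1 + (Y2 * pderiv3 3 (e W 2) + e W 2)) * ((L + A2 * X + C W 2) * Y2)
        = (L + A2 * X + subst3 Q2 (\<Psi> W)) * (Y2 + Y2 * e W 2)"
      using e2 \<theta>[of 2] by algebra
    have c: "comp_map ?Z (\<Psi> W) = vector [X ^ 2, (- L + A1 * X + subst3 Q1 (\<Psi> W)) * (Y1 + Y1 * e W 1),
        (L + A2 * X + subst3 Q2 (\<Psi> W)) * (Y2 + Y2 * e W 2)]"
      using van by (simp add: vec_eq_iff forall_3 subst3_add subst3_diff subst3_uminus subst3_mult
          subst3_power subst3_X subst3_Y1 subst3_Y2 L_def A1_def A2_def) (simp add: \<Psi>_def)
    have j: "(jacobian (\<Psi> W) *v ?N) $ 1 = X ^ 2"
      "(jacobian (\<Psi> W) *v ?N) $ 2 = Y1 * pderiv3 1 (e W 1) * X ^ 2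
        + (1 + (Y1 * pderiv3 2 (e W 1) + e W 1)) * ((- L + A1 * X + C W 1) * Y1)
        + Y1 * pderiv3 3 (e W 1) * ((L + A2 * X + C W 2) * Y2)"
      "(jacobian (\<Psi> W) *v ?N) $ 3 = Y2 * pderiv3 1 (e W 2) * X ^ 2
        + Y2 * pderiv3 2 (e W 2) * ((- L + A1 * X + C W 1) * Y1)
        + (1 + (Y2 * pderiv3 3 (e W 2) + e W 2)) * ((L + A2 * X + C W 2) * Y2)"
      by (simp_all add: jacobian_mult_nth sum_3 \<Psi>_def normal_form_def pderiv3_X pderiv3_add
          pderiv3_mult pderiv3_Y1 pderiv3_Y2 ev L_def A1_def A2_def)
    show ?thesis unfolding c using 1 2 by (simp add: vec_eq_iff forall_3 j)
  qed
  then show ?thesis using that c0 \<Psi>(1)[OF W] by (auto simp: conjugates_def)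
qed

text \<open>A zero would force a = -i/k, a nonpositive rational, or i = k = 0. This is where
  non-degeneracy enters.\<close>

lemma nondegenerate_denominator:
  assumes "a \<notin> {of_rat q | q. q \<le> 0}" "(i, k) \<noteq> (0, 0)"
  shows "of_nat i + a * of_nat k \<noteq> (0 :: complex)"
proof
  assume 0: "of_nat i + a * of_nat k = 0"
  show False
  proof (cases "k = 0")
    case False
    then have "a = of_rat (- (of_nat i / of_nat k))"
      using 0 by (simp add: of_rat_minus of_rat_divide field_simps add_eq_0_iff)
    moreover have "- (of_nat i / of_nat k) \<le> (0 :: rat)" by simp
    ultimately show False using assms(1) by blast
  qed (use 0 assms(2) in auto)
qed

text \<open>Resonant monomials here have j = k + 1, so y1 divides them and leaves a series in x and
  v. Its constant term vanishes as \<open>R1\<close> has order 2, and its only linear term is the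
  multiple of x that is split off.\<close>

lemma resonant_factor:
  assumes "order_ge 2 R1" "resonant (-1) R1 = R1"
  obtains Q where "order_ge 2 Q" "delta Q = 0" "R1 = (const3 (coef3 R1 1 1 0) * X + Q) * Y1"
proof -
  have R1: "coef3 R1 i j k = 0" if "int k - int j \<noteq> - 1" for i j k
    using coef3_resonant[of "-1" R1 i j k] assms(2) that by simp
  define Q where "Q = Abs_fps3 (\<lambda>i j k. coef3 R1 i (Suc j) k) - const3 (coef3 R1 1 1 0) * X"
  have "Y1 * (const3 (coef3 R1 1 1 0) * X + Q) = R1"
  proof (rule fps3_eqI)
    fix i j k show "coef3 (Y1 * (const3 (coef3 R1 1 1 0) * X + Q)) i j k = coef3 R1 i j k"
      by (cases j) (simp_all add: coef3_Y1_mult Q_def R1)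
  qed
  moreover have "delta Q = 0"
    unfolding delta_eq_0_iff by (auto simp: Q_def coef3_X R1)
  moreover have "order_ge 2 Q"
    unfolding order_ge_def
  proof (intro allI impI)
    fix i j k :: nat assume "i + j + k < 2"
    then have "(i = 0 \<and> j = 0 \<and> k = 0) \<or> (i = 1 \<and> j = 0 \<and> k = 0) \<or> j \<noteq> k" by linarith
    then show "coef3 Q i j k = 0"
      using \<open>delta Q = 0\<close> order_geD[OF assms(1), of 0 1 0]
      by (auto simp: delta_eq_0_iff, auto simp: Q_def coef3_X)
  qed
  ultimately show ?thesis using that by (simp add: mult.commute)
qed

lemma resonant_factor':
  assumes "order_ge 2 R2" "resonant 1 R2 = R2"
  obtains Q where "order_ge 2 Q" "delta Q = 0" "R2 = (const3 (coef3 R2 1 0 1) * X + Q) * Y2"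
proof -
  have R2: "coef3 R2 i j k = 0" if "int k - int j \<noteq> 1" for i j k
    using coef3_resonant[of 1 R2 i j k] assms(2) that by simp
  define Q where "Q = Abs_fps3 (\<lambda>i j k. coef3 R2 i j (Suc k)) - const3 (coef3 R2 1 0 1) * X"
  have "Y2 * (const3 (coef3 R2 1 0 1) * X + Q) = R2"
  proof (rule fps3_eqI)
    fix i j k show "coef3 (Y2 * (const3 (coef3 R2 1 0 1) * X + Q)) i j k = coef3 R2 i j k"
      by (cases k) (simp_all add: coef3_Y2_mult Q_def R2)
  qed
  moreover have "delta Q = 0"
    unfolding delta_eq_0_iff by (auto simp: Q_def coef3_X R2)
  moreover have "order_ge 2 Q"
    unfolding order_ge_def
  proof (intro allI impI)
    fix i j k :: nat assume "i + j + k < 2"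
    then have "(i = 0 \<and> j = 0 \<and> k = 0) \<or> (i = 1 \<and> j = 0 \<and> k = 0) \<or> j \<noteq> k" by linarith
    then show "coef3 Q i j k = 0"
      using \<open>delta Q = 0\<close> order_geD[OF assms(1), of 0 0 1]
      by (auto simp: delta_eq_0_iff, auto simp: Q_def coef3_X)
  qed
  ultimately show ?thesis using that by (simp add: mult.commute)
qed

subsection \<open>Exchanging \<open>y1\<close> and \<open>y2\<close>\<close>

definition swap :: "fps3 ^ 3" where "swap = vector [X, Y2, Y1]"

lemma swap_nth [simp]: "swap $ 1 = X" "swap $ 2 = Y2" "swap $ 3 = Y1"
  by (simp_all add: swap_def vector_3)

lemma vanishing_swap [simp]: "vanishing swap"
  by (simp add: vanishing_def forall_3)

lemma coef3_subst3_swap: "coef3 (subst3 F swap) i j k = coef3 F i k j"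
proof (induction F arbitrary: i j k rule: fps3_induct)
  case (limit F)
  obtain G where G: "\<And>i j k. coef3 (subst3 G swap) i j k = coef3 G i k j"
    "order_ge (Suc (i + j + k)) (F - G)"
    using limit by blast
  have "order_ge (Suc (i + j + k)) (subst3 (F - G) swap)"
    using G(2) by (rule order_ge_subst3) simp
  from order_geD[OF this, of i j k] order_geD[OF G(2), of i k j] show ?case
    by (simp add: subst3_diff G(1))
qed (auto simp: subst3_add subst3_var_mult coef3_const3 coef3_X_mult coef3_Y1_mult coef3_Y2_mult)

lemma swap_Diff_fib: "swap \<in> Diff_fib"
proof -
  have "comp_map swap swap = id_map"
    by (simp add: vec_eq_iff forall_3 subst3_X subst3_Y1 subst3_Y2)
  then have "lin0 swap ** lin0 swap = mat 1"
    using lin0_comp_map[of swap swap] by simp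
  then show ?thesis by (auto simp: Diff_fib_iff invertible_def)
qed

text \<open>The product v is symmetric, so the exchange only permutes the two coefficient series,
  and l is replaced by its negative.\<close>

lemma conjugates_swap_normal_form:
  "conjugates swap (normal_form (- l) a1 a2 c1 c2) (normal_form l a2 a1 c2 c1)"
proof -
  have "subst3 (eval_v c) swap = eval_v c" for c
    by (rule fps3_eqI) (auto simp: coef3_subst3_swap coef3_eval_v)
  then show ?thesis
    by (simp add: conjugates_def swap_Diff_fib vec_eq_iff forall_3 jacobian_mult_nth sum_3
        pderiv3_X pderiv3_Y1 pderiv3_Y2 normal_form_def vector_3 subst3_add subst3_diff subst3_uminus subst3_mult
        subst3_power subst3_X subst3_Y1 subst3_Y2 const3_minus)
qed

subsection \<open>Prepared vector fields\<close>

lemma preparedE: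
  assumes "prepared l Z"
  obtains F1 F2 where "order_ge 2 F1" "order_ge 2 F2"
    "Z = vector [X ^ 2, - const3 l * Y1 + F1, const3 l * Y2 + F2]"
  using assms by (auto simp: prepared_def max_ideal_sq_iff)

text \<open>The value of the trace divided by x at x = 0 is the x-coefficient of the trace, to which
  the constants -l and l do not contribute.\<close>

lemma prepared_res_eq:
  "prepared_res (vector [X ^ 2, - const3 l * Y1 + F1, const3 l * Y2 + F2])
    = coef3 F1 1 1 0 + coef3 F2 1 0 1"
proof -
  have "prepared_res Z = coef3 (Z $ 2) 1 1 0 + coef3 (Z $ 3) 1 0 1" for Z
    by (simp add: prepared_res_def lin_part_def trace_def sum_2 vector_2 coef3_def)
  then show ?thesis by (simp add: vector_3 coef3_Y1 coef3_Y2)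
qed

lemma prepared_normal_form:
  assumes "prepared l Z" "prepared_res Z \<notin> {of_rat q | q. q \<le> 0}"
  obtains \<Phi> a1 a2 c1 c2 where "fps_nth c1 0 = 0" "fps_nth c2 0 = 0" "a1 + a2 = prepared_res Z"
    "conjugates \<Phi> Z (normal_form l a1 a2 c1 c2)"
proof -
  obtain F1 F2 where F: "order_ge 2 F1" "order_ge 2 F2"
    and Z: "Z = vector [X ^ 2, - const3 l * Y1 + F1, const3 l * Y2 + F2]"
    using assms(1) by (rule preparedE)
  have "l \<noteq> 0" using assms(1) by (simp add: prepared_def)
  obtain \<Psi> R1 R2 where R: "order_ge 2 R1" "order_ge 2 R2" "resonant (-1) R1 = R1" "resonant 1 R2 = R2"
    and a: "coef3 R1 1 1 0 = coef3 F1 1 1 0" "coef3 R2 1 0 1 = coef3 F2 1 0 1"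
    and \<Psi>: "conjugates \<Psi> (vector [X ^ 2, - const3 l * Y1 + R1, const3 l * Y2 + R2]) Z"
    unfolding Z by (rule poincare_dulac[OF \<open>l \<noteq> 0\<close> F])
  define a1 where "a1 = coef3 R1 1 1 0"
  define a2 where "a2 = coef3 R2 1 0 1"
  obtain Q1 where Q1: "order_ge 2 Q1" "delta Q1 = 0" "R1 = (const3 a1 * X + Q1) * Y1"
    using R unfolding a1_def by (rule_tac resonant_factor)
  obtain Q2 where Q2: "order_ge 2 Q2" "delta Q2 = 0" "R2 = (const3 a2 * X + Q2) * Y2"
    using R unfolding a2_def by (rule_tac resonant_factor')
  have aa: "a1 + a2 = prepared_res Z" unfolding Z prepared_res_eq a1_def a2_def a by (rule refl)
  have nd: "of_nat i + (a1 + a2) * of_nat k \<noteq> 0" if "(i, k) \<noteq> (0, 0)" for i k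
    unfolding aa using assms(2) that by (rule nondegenerate_denominator)
  obtain \<Theta> c1 c2 where c: "fps_nth c1 0 = 0" "fps_nth c2 0 = 0"
    and \<Theta>: "conjugates \<Theta> (normal_form l a1 a2 c1 c2)
       (vector [X ^ 2, (- const3 l + const3 a1 * X + Q1) * Y1, (const3 l + const3 a2 * X + Q2) * Y2])"
    by (rule resonant_normalisation[OF Q1(1) Q2(1) Q1(2) Q2(2) nd])
  have "- const3 l * Y1 + R1 = (- const3 l + const3 a1 * X + Q1) * Y1"
    "const3 l * Y2 + R2 = (const3 l + const3 a2 * X + Q2) * Y2"
    by (simp_all add: Q1(3) Q2(3) distrib_right left_diff_distrib)
  \<comment> \<open>Both conjugations start at the simpler field, so their composite leads from the
    normal form to \<open>Z\<close> and has to be inverted.\<close>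
  note conjugates_trans[OF \<Theta> \<Psi>[unfolded this]]
  from that[OF c aa conjugates_inv_map[OF this]] show ?thesis .
qed

section \<open>Linear parts at the origin and the sign of the eigenvalue\<close>

lemma lin0_jacobian_mult:
  assumes "vanishing Y"
  shows "lin0 (jacobian \<Phi> *v Y) = lin0 \<Phi> ** lin0 Y"
proof -
  have "coef3 (Y $ m) 0 0 0 = 0" for m
    using order_geD[OF vanishingD[OF assms], of 0 0 0] by simp
  then show ?thesis
    by (simp add: lin0_def vec_eq_iff matrix_matrix_mult_def jacobian_mult_nth pderiv3_sum pderiv3_mult)
qed

lemma prepared_lin0:
  assumes "prepared l Z"
  shows "vanishing Z"
    "lin0 Z = (\<chi> i j. if i = j then if i = 1 then 0 else if i = 2 then - l else l else 0)"
proof -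
  obtain F1 F2 where F: "order_ge 2 F1" "order_ge 2 F2"
    and Z: "Z = vector [X ^ 2, - const3 l * Y1 + F1, const3 l * Y2 + F2]"
    using assms by (rule preparedE)
  show "vanishing Z"
    using F[THEN order_ge_antimono, of 1] order_ge_multL[OF order_ge_X, of X]
    by (auto simp: Z vanishing_def forall_3 vector_3 power2_eq_square
        intro!: order_ge_add order_ge_diff order_ge_multR)
  have 1: "order_ge 1 (pderiv3 m F1)" "order_ge 1 (pderiv3 m F2)" for m
    using order_ge_pderiv3'[OF F(1)] order_ge_pderiv3'[OF F(2)] by simp_all
  show "lin0 Z = (\<chi> i j. if i = j then if i = 1 then 0 else if i = 2 then - l else l else 0)"
    using order_geD[OF 1(1), of 0 0 0] order_geD[OF 1(2), of 0 0 0]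
    by (simp add: lin0_def vec_eq_iff forall_3 vector_3 Z pderiv3_add pderiv3_diff pderiv3_uminus power2_eq_square
        pderiv3_mult pderiv3_X pderiv3_Y1 pderiv3_Y2 coef3_one coef3_const3 coef3_X)
qed

text \<open>The second row of the linear part of \<open>\<Phi>\<close> satisfies the equation of a
  left eigenvector of \<open>lin0 Z\<close> for the value -l'. If -l' is none of 0, -l, l, this row
  vanishes, against invertibility.\<close>

lemma conjugate_prepared_eigenvalues:
  assumes "prepared l Z" "prepared l' Z'" "conjugates \<Phi> Z Z'"
  shows "l' = l \<or> l' = - l"
proof (rule ccontr)
  assume ne: "\<not> ?thesis"
  have \<Phi>: "vanishing \<Phi>" "invertible (lin0 \<Phi>)"
    and eq: "jacobian \<Phi> *v Z = comp_map Z' \<Phi>"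
    using assms(3) by (auto simp: conjugates_def Diff_fib_iff)
  have "l' \<noteq> 0" using assms(2) by (simp add: prepared_def)
  have "lin0 \<Phi> ** lin0 Z = lin0 Z' ** lin0 \<Phi>"
    using arg_cong[OF eq, of lin0] assms \<Phi>
    by (simp add: lin0_jacobian_mult prepared_lin0(1) lin0_comp_map)
  then have "(lin0 \<Phi> ** lin0 Z) $ 2 $ m = (lin0 Z' ** lin0 \<Phi>) $ 2 $ m" for m by simp
  note e = this[unfolded prepared_lin0(2)[OF assms(1)] prepared_lin0(2)[OF assms(2)]
    matrix_matrix_mult_def, simplified sum_3]
  have "lin0 \<Phi> $ 2 $ 1 = 0" using e[of 1] \<open>l' \<noteq> 0\<close> by simp
  moreover have "lin0 \<Phi> $ 2 $ 2 = 0" using e[of 2] ne by auto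
  moreover have "lin0 \<Phi> $ 2 $ 3 = 0"
  proof -
    have "lin0 \<Phi> $ 2 $ 3 * l = lin0 \<Phi> $ 2 $ 3 * (- l')" using e[of 3] by simp
    then have "lin0 \<Phi> $ 2 $ 3 = 0 \<or> l = - l'" by (simp only: mult_cancel_left)
    then show ?thesis using ne by (metis minus_minus)
  qed
  ultimately have 0: "lin0 \<Phi> $ 2 $ m = 0" for m
    using exhaust_3[of m] by auto
  obtain B where "lin0 \<Phi> ** B = mat 1" using \<Phi>(2) by (auto simp: invertible_def)
  then have "(lin0 \<Phi> ** B) $ 2 $ 2 = 1" by (simp add: mat_def)
  then show False by (simp add: matrix_matrix_mult_def 0)
qed

section \<open>The normal form for the prescribed eigenvalue\<close>

theorem theorem1p3:
  fixes Y :: "fps3 ^ 3" and l :: complex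
  assumes "Y \<in> SN_nd"
    and "l \<noteq> 0"
    and "\<exists>Z. fib_conj_prepared Y l Z"
  shows "\<exists>\<Phi>\<in>Diff_fib. \<exists>a1 a2 c1 c2.
           fps_nth c1 0 = 0 \<and> fps_nth c2 0 = 0 \<and> a1 + a2 = res Y \<and>
           push_forward \<Phi> Y = normal_form l a1 a2 c1 c2"
proof -
  have fib: "fib_conj_prepared Y l Z \<longleftrightarrow> prepared l Z \<and> (\<exists>\<Phi>. conjugates \<Phi> Y Z)" for l Z
    by (auto simp: fib_conj_prepared_def conjugates_iff_push_forward)
  \<comment> \<open>The conjugate on which \<open>res\<close> is evaluated; its eigenvalue
    \<open>l0\<close> may differ from \<open>l\<close>.\<close>
  define Z0 where "Z0 = (SOME Z. \<exists>l. fib_conj_prepared Y l Z)"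
  have "\<exists>l. fib_conj_prepared Y l Z0"
    unfolding Z0_def using assms(3) by (intro someI_ex[of "\<lambda>Z. \<exists>l. fib_conj_prepared Y l Z"]) blast
  then obtain l0 \<Phi>0 where Z0: "prepared l0 Z0" "conjugates \<Phi>0 Y Z0" by (auto simp: fib)
  obtain Z \<Phi> where Z: "prepared l Z" "conjugates \<Phi> Y Z" using assms(3) by (auto simp: fib)
  have res: "res Y = prepared_res Z0" by (simp add: res_def Z0_def)
  have "prepared_res Z0 \<notin> {of_rat q | q. q \<le> 0}" using assms(1) by (simp add: SN_nd_def res)
  then obtain \<Psi> a1 a2 c1 c2 where c: "fps_nth c1 0 = 0" "fps_nth c2 0 = 0"
    and a: "a1 + a2 = res Y" and "conjugates \<Psi> Z0 (normal_form l0 a1 a2 c1 c2)"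
    unfolding res by (rule prepared_normal_form[OF Z0(1)])
  from conjugates_trans[OF Z0(2) this(4)]
  have conj: "conjugates (comp_map \<Psi> \<Phi>0) Y (normal_form l0 a1 a2 c1 c2)" .
  \<comment> \<open>Both \<open>Z0\<close> and \<open>Z\<close> are conjugate to \<open>Y\<close>,
    hence to each other.\<close>
  have "l = l0 \<or> l = - l0"
    using conjugate_prepared_eigenvalues[OF Z0(1) Z(1)]
      conjugates_trans[OF conjugates_inv_map[OF Z0(2)] Z(2)] by blast
  then have "\<exists>\<Phi> a1 a2 c1 c2. fps_nth c1 0 = 0 \<and> fps_nth c2 0 = 0 \<and> a1 + a2 = res Y \<and>
      conjugates \<Phi> Y (normal_form l a1 a2 c1 c2)"
  proof
    assume "l = l0"
    then show ?thesis using c a conj by blast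
  next
    \<comment> \<open>The exchange corrects the sign of the eigenvalue and leaves the sum of
      \<open>a1\<close> and \<open>a2\<close> unchanged.\<close>
    assume "l = - l0"
    then have "conjugates (comp_map swap (comp_map \<Psi> \<Phi>0)) Y (normal_form l a2 a1 c2 c1)"
      using conjugates_trans[OF conj] conjugates_swap_normal_form[of l a1 a2 c1 c2] by simp
    moreover have "a2 + a1 = res Y" using a by (simp add: add.commute)
    ultimately show ?thesis using c by blast
  qed
  then show ?thesis unfolding conjugates_iff_push_forward by blast
qed

end
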